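(* In the setting and notation of the context, suppose that: (1) (uniform convergence) uniform convergence holds over $\mathcal H$ for the losses $\ell_0$, $\ell$ and $\mathbb I\{\ell\le 0\}$ with rates $\zeta_0=\zeta_0(N,\delta)$, $\zeta=\zeta(N,\delta)$ and $\zeta_I=\zeta_I(N,\delta)$; (2) (dual attainment) the statistical and empirical dual optimal solutions $\lambda^\star\in L^1_+(\mathcal D)$ and $\hat\lambda^\star\in\mathbb R_+^N$ exist; (3) (bounded multiplier) $\|\lambda^\star\|_\infty\le\gamma<\infty$; (4) the constraint loss $\ell$ is convex and the objective loss $\ell_0$ is strongly convex (as functionals of the predictor); (5) (near universality) there exist constants $\nu,\nu_0\ge0$ such that for every $\phi\in\hat{\mathcal H}$ there is $f_\theta\in\mathcal H$ with $\mathbb E_{\mathcal D_0}[\|\phi(\mathbf x)-f_\theta(\mathbf x)\|]\le\nu_0$ and $\|\phi(\mathbf x)-f_\theta(\mathbf x)\|\le\nu$ $\mathcal D$-almost everywhere; (6) (Lipschitz losses) $\ell$ and $\ell_0$, as functions on $\mathcal Y\times\mathcal Y$, are $M$-Lipschitz in their first argument; (7) (dual attainability of the tightened problem) the dual of the convexified problem with constraints tightened by $M\nu$ has an optimal solution $\lambda^\star_{M\nu}\in L^1_+(\mathcal D)$. Let $\Delta_{\mathrm{gap}}:=M\nu\,\mathbb E_{\mathcal D}[\lambda^\star_{M\nu}(\mathbf z)]+M\nu_0$, and let $\bar f_\theta$ be the estimator returned by (i.e. a solution of) the empirical constrained problem $\hat P^\star$. Then, for every $\delta\in(0,1)$, with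 probability at least $1-5\delta$ over the samples, $$\Big|\mathbb E_{\mathbf z\sim\mathcal D_0}[\ell_0(\bar f_\theta,\mathbf z)]-P^\star\Big|\le\Delta_{\mathrm{gap}}+3\zeta_0+\gamma\zeta,\qquad \Pr_{\mathbf z\sim\mathcal D}\big[\ell(\bar f_\theta,\mathbf z)\le0\big]\ge1-\zeta_I .$$ (In this sense the empirical constrained problem is a near-PACC learner for the statistical one.)
   Context: Setting. $\mathcal X,\mathcal Y$ are the input and output spaces ($\mathcal Y$ a convex subset of a normed space), $\mathcal Z=\mathcal X\times\mathcal Y$, $\mathbf z=(\mathbf x,y)$. $\mathcal D_0,\mathcal D$ are probability distributions on $\mathcal Z$. $\mathcal H=\{f_\theta:\theta\in\Theta\subseteq\mathbb R^p\}$ is a class of predictors $f_\theta:\mathcal X\to\mathcal Y$, and $\hat{\mathcal H}=\overline{\mathrm{conv}}(\mathcal H)$ is its closed convex hull, the closure being taken in the $\|\cdot\|_\infty$ (sup) norm. The objective loss is $\ell_0:\mathcal Y\times\mathcal Y\to[0,B]$; the constraint loss is $\ell=\ell_1-c$ with $\ell_1:\mathcal Y\times\mathcal Y\to[0,B]$ and a threshold $c\in\mathbb R$. Write $\ell(f,\mathbf z)=\ell(f(\mathbf x),y)$, similarly for $\ell_0$. Convexity of $\ell$ (strong convexity of $\ell_0$) means that for every $\mathbf z$ the map $f\mapsto\ell(f,\mathbf z)$ is convex (resp. $f\mapsto\ell_0(f,\mathbf z)$ is strongly convex with respect to the norm of the predictor space). Minima are assumed attained wherever "min" or "argmin" is written.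 Samples. $S_0=\{\mathbf z^0_n\}_{n=1}^N$ is i.i.d. from $\mathcal D_0$ and $S=\{\mathbf z_n\}_{n=1}^N$ is i.i.d. from $\mathcal D$ (if $\mathcal D_0=\mathcal D$ one may take $S_0=S$). Primal problems. $P^\star=\min_{f\in\mathcal H}\mathbb E_{\mathcal D_0}[\ell_0(f,\mathbf z)]$ subject to $\ell(f,\mathbf z)\le0$ for $\mathcal D$-almost every $\mathbf z$. $\hat P^\star=\min_{f\in\mathcal H}\frac1N\sum_{n=1}^N\ell_0(f,\mathbf z^0_n)$ subject to $\ell(f,\mathbf z_n)\le0$ for $n=1,\dots,N$. The convexified problem tightened by $M\nu$ is $\min_{\phi\in\hat{\mathcal H}}\mathbb E_{\mathcal D_0}[\ell_0(\phi,\mathbf z)]$ subject to $\ell(\phi,\mathbf z)\le-M\nu$ $\mathcal D$-a.e.; its dual is $\sup_{\lambda\in L^1_+(\mathcal D)}\min_{\phi\in\hat{\mathcal H}}\{\mathbb E_{\mathcal D_0}[\ell_0(\phi,\mathbf z)]+\mathbb E_{\mathcal D}[\lambda(\mathbf z)(\ell(\phi,\mathbf z)+M\nu)]\}$. Uniform convergence. A loss $h$ satisfies uniform convergence over $\mathcal H$ with rate $\zeta_h(N,\delta)\ge 0$ (decreasing in $N$) if, for every distribution $\mathcal Q$ on $\mathcal Z$, with probability at least $1-\delta$ over $N$ i.i.d. samples $\mathbf z_n\sim\mathcal Q$, $\big|\mathbb E_{\mathcal Q}[h(f,\mathbf z)]-\frac1N\sum_n h(f,\mathbf z_n)\big|\le\zeta_h(N,\delta)$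 for all $f\in\mathcal H$ simultaneously (the rate may depend on $\mathcal Q$; $\zeta_0$ is used with $\mathcal D_0$, and $\zeta,\zeta_I$ with $\mathcal D$). Standing assumption: the rates come from vanishing Rademacher complexity, i.e. $\zeta_h(N,\delta)=2\mathcal R_N(h\circ\mathcal H)+B_h\sqrt{\log(2/\delta)/(2N)}$ with $\mathcal R_N(h\circ\mathcal H)=\frac1N\mathbb E_{S}\mathbb E_\sigma\big[\sup_{f\in\mathcal H}\sum_{n=1}^N\sigma_n h(f,\mathbf z_n)\big]\to0$, $\sigma_n$ i.i.d. uniform on $\{\pm1\}$, and $B_h=B$ for $\ell_0,\ell$ and $B_h=1$ for the indicator. Dual problems. For $\lambda\in L^1_+(\mathcal D)$ (nonnegative $\mathcal D$-integrable functions), $L(f,\lambda)=\mathbb E_{\mathcal D_0}[\ell_0(f,\mathbf z)]+\mathbb E_{\mathcal D}[\lambda(\mathbf z)\ell(f,\mathbf z)]$, $g(\lambda)=\min_{f\in\mathcal H}L(f,\lambda)$, and $\lambda^\star$ is a maximizer of $g$ over $L^1_+(\mathcal D)$. For $\lambda\in\mathbb R^N_+$, $\hat L(f,\lambda)=\frac1N\sum_{n}\ell_0(f,\mathbf z^0_n)+\frac1N\sum_{n}\lambda_n\ell(f,\mathbf z_n)$, $\hat g(\lambda)=\min_{f\in\mathcal H}\hat L(f,\lambda)$, and $\hat\lambda^\star$ is a maximizer of $\hat g$ over $\mathbb R^N_+$. $\|\cdot\|_\infty$ of a multiplier is the $L^\infty(\mathcal D)$ norm. *)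

theory Defs
  imports "HOL-Probability.Probability"
begin

text \<open>
  Conventions. The input space is the type \<open>'x\<close>, the output space a set \<open>Y\<close> in a normed space, and
  \<open>Z\<close> is a measurable space with carrier \<open>UNIV \<times> Y\<close> whose \<open>\<sigma>\<close>-algebra is arbitrary. The
  distributions on it are the elements of \<open>space (prob_algebra Z)\<close>.
\<close>

section \<open>Predictor classes\<close>

definition mix :: "real \<Rightarrow> ('x \<Rightarrow> 'y) \<Rightarrow> ('x \<Rightarrow> 'y) \<Rightarrow> 'x \<Rightarrow> 'y::real_normed_vector" where
  "mix t f g = (\<lambda>x. (1 - t) *\<^sub>R f x + t *\<^sub>R g x)"

definition convex_class :: "('x \<Rightarrow> 'y::real_normed_vector) set \<Rightarrow> bool" where
  "convex_class C \<longleftrightarrow> (\<forall>f\<in>C. \<forall>g\<in>C. \<forall>t\<in>{0..1}. mix t f g \<in> C)"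

text \<open>Extended-valued, because predictors need not be bounded.\<close>

definition sup_norm :: "('x \<Rightarrow> 'y::real_normed_vector) \<Rightarrow> ereal" where
  "sup_norm u = (SUP x. ereal (norm (u x)))"

text \<open>
  The closure is taken among the \<open>Y\<close>-valued functions: \<open>Y\<close> need not be closed, and losses are only
  meaningful on \<open>Y\<close>.
\<close>

definition closed_convex_hull :: "'y set \<Rightarrow> ('x \<Rightarrow> 'y::real_normed_vector) set \<Rightarrow> ('x \<Rightarrow> 'y) set" where
  "closed_convex_hull Y H =
     {\<phi>. (\<forall>x. \<phi> x \<in> Y) \<and> (\<forall>e>0. \<exists>\<psi>\<in>convex_class hull H. sup_norm (\<lambda>x. \<phi> x - \<psi> x) < ereal e)}"


section \<open>Losses\<close>

definition loss_at :: "('y \<Rightarrow> 'y \<Rightarrow> real) \<Rightarrow> ('x \<Rightarrow> 'y) \<Rightarrow> 'x \<times> 'y \<Rightarrow> real" where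
  "loss_at l f z = l (f (fst z)) (snd z)"

definition convex_loss ::
  "('x \<times> 'y) measure \<Rightarrow> ('x \<Rightarrow> 'y::real_normed_vector) set \<Rightarrow> ('y \<Rightarrow> 'y \<Rightarrow> real) \<Rightarrow> bool" where
  "convex_loss Z C l \<longleftrightarrow>
     (\<forall>z\<in>space Z. \<forall>f\<in>C. \<forall>g\<in>C. \<forall>t\<in>{0..1}.
        loss_at l (mix t f g) z \<le> (1 - t) * loss_at l f z + t * loss_at l g z)"

text \<open>
  The predictor space carries the sup norm. Two predictors of \<open>C\<close> at infinite distance violate the
  inequality (take \<open>t = 1/2\<close>).
\<close>

definition strongly_convex_loss ::
  "('x \<times> 'y) measure \<Rightarrow> ('x \<Rightarrow> 'y::real_normed_vector) set \<Rightarrow> ('y \<Rightarrow> 'y \<Rightarrow> real) \<Rightarrow> bool" where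
  "strongly_convex_loss Z C l \<longleftrightarrow>
     (\<exists>m>0. \<forall>z\<in>space Z. \<forall>f\<in>C. \<forall>g\<in>C. \<forall>t\<in>{0..1}.
        ereal (loss_at l (mix t f g) z) + ereal (m / 2 * (t * (1 - t))) * (sup_norm (\<lambda>x. f x - g x))\<^sup>2
          \<le> ereal ((1 - t) * loss_at l f z + t * loss_at l g z))"


section \<open>Statistical problems and their duals\<close>

definition risk :: "('x \<times> 'y) measure \<Rightarrow> ('y \<Rightarrow> 'y \<Rightarrow> real) \<Rightarrow> ('x \<Rightarrow> 'y) \<Rightarrow> real" where
  "risk D l f = (\<integral>z. loss_at l f z \<partial>D)"

definition feasible ::
  "('x \<times> 'y) measure \<Rightarrow> ('y \<Rightarrow> 'y \<Rightarrow> real) \<Rightarrow> ('x \<Rightarrow> 'y) set \<Rightarrow> ('x \<Rightarrow> 'y) set" where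
  "feasible D l C = {f\<in>C. AE z in D. loss_at l f z \<le> 0}"

definition primal_value ::
  "('x \<times> 'y) measure \<Rightarrow> ('x \<times> 'y) measure \<Rightarrow> ('y \<Rightarrow> 'y \<Rightarrow> real) \<Rightarrow> ('y \<Rightarrow> 'y \<Rightarrow> real)
     \<Rightarrow> ('x \<Rightarrow> 'y) set \<Rightarrow> real" where
  "primal_value D0 D l0 l C = (INF f\<in>feasible D l C. risk D0 l0 f)"

definition L1_plus :: "'z measure \<Rightarrow> ('z \<Rightarrow> real) set" where
  "L1_plus D = {lam. integrable D lam \<and> (AE z in D. 0 \<le> lam z)}"

definition lagrangian ::
  "('x \<times> 'y) measure \<Rightarrow> ('x \<times> 'y) measure \<Rightarrow> ('y \<Rightarrow> 'y \<Rightarrow> real) \<Rightarrow> ('y \<Rightarrow> 'y \<Rightarrow> real)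
     \<Rightarrow> ('x \<times> 'y \<Rightarrow> real) \<Rightarrow> ('x \<Rightarrow> 'y) \<Rightarrow> real" where
  "lagrangian D0 D l0 l lam f = risk D0 l0 f + (\<integral>z. lam z * loss_at l f z \<partial>D)"

definition dual_fun ::
  "('x \<times> 'y) measure \<Rightarrow> ('x \<times> 'y) measure \<Rightarrow> ('y \<Rightarrow> 'y \<Rightarrow> real) \<Rightarrow> ('y \<Rightarrow> 'y \<Rightarrow> real)
     \<Rightarrow> ('x \<Rightarrow> 'y) set \<Rightarrow> ('x \<times> 'y \<Rightarrow> real) \<Rightarrow> real" where
  "dual_fun D0 D l0 l C lam = (INF f\<in>C. lagrangian D0 D l0 l lam f)"

text \<open>
  The constraint \<open>l \<le> - k\<close> is the constraint \<open>l + k \<le> 0\<close>, so tightened problems and their duals are the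
  above with \<open>tighten k l\<close> as constraint loss.
\<close>

definition tighten :: "real \<Rightarrow> ('y \<Rightarrow> 'y \<Rightarrow> real) \<Rightarrow> 'y \<Rightarrow> 'y \<Rightarrow> real" where
  "tighten k l = (\<lambda>u y. l u y + k)"


section \<open>Empirical problems and their duals\<close>

text \<open>A sample of size \<open>N\<close> is given by the values of a function on \<open>{..<N}\<close>.\<close>

definition emp_risk :: "nat \<Rightarrow> (nat \<Rightarrow> 'x \<times> 'y) \<Rightarrow> ('y \<Rightarrow> 'y \<Rightarrow> real) \<Rightarrow> ('x \<Rightarrow> 'y) \<Rightarrow> real" where
  "emp_risk N S l f = 1 / real N * (\<Sum>n<N. loss_at l f (S n))"

definition emp_feasible ::
  "nat \<Rightarrow> (nat \<Rightarrow> 'x \<times> 'y) \<Rightarrow> ('y \<Rightarrow> 'y \<Rightarrow> real) \<Rightarrow> ('x \<Rightarrow> 'y) set \<Rightarrow> ('x \<Rightarrow> 'y) set" where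
  "emp_feasible N S l C = {f\<in>C. \<forall>n<N. loss_at l f (S n) \<le> 0}"

definition emp_multipliers :: "nat \<Rightarrow> (nat \<Rightarrow> real) set" where
  "emp_multipliers N = {..<N} \<rightarrow>\<^sub>E {0..}"

definition emp_lagrangian ::
  "nat \<Rightarrow> (nat \<Rightarrow> 'x \<times> 'y) \<Rightarrow> (nat \<Rightarrow> 'x \<times> 'y) \<Rightarrow> ('y \<Rightarrow> 'y \<Rightarrow> real) \<Rightarrow> ('y \<Rightarrow> 'y \<Rightarrow> real)
     \<Rightarrow> (nat \<Rightarrow> real) \<Rightarrow> ('x \<Rightarrow> 'y) \<Rightarrow> real" where
  "emp_lagrangian N S0 S l0 l lam f =
     emp_risk N S0 l0 f + 1 / real N * (\<Sum>n<N. lam n * loss_at l f (S n))"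

definition emp_dual_fun ::
  "nat \<Rightarrow> (nat \<Rightarrow> 'x \<times> 'y) \<Rightarrow> (nat \<Rightarrow> 'x \<times> 'y) \<Rightarrow> ('y \<Rightarrow> 'y \<Rightarrow> real) \<Rightarrow> ('y \<Rightarrow> 'y \<Rightarrow> real)
     \<Rightarrow> ('x \<Rightarrow> 'y) set \<Rightarrow> (nat \<Rightarrow> real) \<Rightarrow> real" where
  "emp_dual_fun N S0 S l0 l C lam = (INF f\<in>C. emp_lagrangian N S0 S l0 l lam f)"


section \<open>Uniform convergence\<close>

text \<open>
  ``With probability at least \<open>p\<close>'' as an inner probability: an event quantifying over an uncountable
  class, or involving an arbitrary choice of minimizers, need not be measurable.
\<close>

definition with_prob_ge :: "'w measure \<Rightarrow> real \<Rightarrow> ('w \<Rightarrow> bool) \<Rightarrow> bool" where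
  "with_prob_ge P p E \<longleftrightarrow> (\<exists>A\<in>sets P. p \<le> measure P A \<and> (\<forall>w\<in>A. E w))"

text \<open>The rate \<open>r Q N \<delta>\<close> may depend on the distribution \<open>Q\<close>.\<close>

definition uniform_convergence ::
  "'z measure \<Rightarrow> 'f set \<Rightarrow> ('f \<Rightarrow> 'z \<Rightarrow> real) \<Rightarrow> ('z measure \<Rightarrow> nat \<Rightarrow> real \<Rightarrow> real) \<Rightarrow> bool" where
  "uniform_convergence Z H h r \<longleftrightarrow>
     (\<forall>Q\<in>space (prob_algebra Z). \<forall>N\<ge>1. \<forall>\<delta>\<in>{0<..<1}.
        0 \<le> r Q N \<delta> \<and> (\<forall>N'\<ge>N. r Q N' \<delta> \<le> r Q N \<delta>) \<and>
        with_prob_ge (Pi\<^sub>M {..<N} (\<lambda>_. Q)) (1 - \<delta>)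
          (\<lambda>S. \<forall>f\<in>H. \<bar>(\<integral>z. h f z \<partial>Q) - 1 / real N * (\<Sum>n<N. h f (S n))\<bar> \<le> r Q N \<delta>))"

definition signed_sup :: "'f set \<Rightarrow> ('f \<Rightarrow> 'z \<Rightarrow> real) \<Rightarrow> nat \<Rightarrow> (nat \<Rightarrow> real) \<Rightarrow> (nat \<Rightarrow> 'z) \<Rightarrow> real" where
  "signed_sup H h N s S = (SUP f\<in>H. \<Sum>n<N. s n * h f (S n))"

definition signs :: "nat \<Rightarrow> (nat \<Rightarrow> real) set" where
  "signs N = {..<N} \<rightarrow>\<^sub>E {-1, 1}"

definition rademacher :: "'z measure \<Rightarrow> 'f set \<Rightarrow> ('f \<Rightarrow> 'z \<Rightarrow> real) \<Rightarrow> nat \<Rightarrow> real" where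
  "rademacher Q H h N =
     1 / real N * (\<integral>S. measure_pmf.expectation (pmf_of_set (signs N)) (\<lambda>s. signed_sup H h N s S)
                    \<partial>Pi\<^sub>M {..<N} (\<lambda>_. Q))"

text \<open>
  The measurability conjunct makes the expectation defining the Rademacher complexity meaningful:
  the supremum ranges over an uncountable class, and the Bochner integral of a non-measurable function
  is \<open>0\<close>.
\<close>

definition rademacher_rate ::
  "'z measure \<Rightarrow> 'f set \<Rightarrow> ('f \<Rightarrow> 'z \<Rightarrow> real) \<Rightarrow> real \<Rightarrow> ('z measure \<Rightarrow> nat \<Rightarrow> real \<Rightarrow> real) \<Rightarrow> bool" where
  "rademacher_rate Z H h b r \<longleftrightarrow>
     (\<forall>N. \<forall>s\<in>signs N. signed_sup H h N s \<in> borel_measurable (Pi\<^sub>M {..<N} (\<lambda>_. Z))) \<and>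
     (\<forall>Q\<in>space (prob_algebra Z).
        (\<forall>N\<ge>1. \<forall>\<delta>\<in>{0<..<1}.
           r Q N \<delta> = 2 * rademacher Q H h N + b * sqrt (ln (2 / \<delta>) / (2 * real N))) \<and>
        rademacher Q H h \<longlonglongrightarrow> 0)"

end

theory Submission
  imports Defs
begin

text \<open>
  Upper bound: the statistical solution is almost surely feasible for the sampled constraints, so
  uniform convergence of \<open>l0\<close>, used twice, compares its risk with that of the estimator.

  Lower bound: by definition of the dual function, the risk of the estimator is at least
  \<open>g(\<lambda>\<^sup>\<star>) - E[\<lambda>\<^sup>\<star> l(f)]\<close>. The empirical average of \<open>\<lambda>\<^sup>\<star> l(f)\<close> is nonpositive, and its
  expectation is larger by at most \<open>\<gamma> \<zeta>\<close>: symmetrization, contraction (\<open>0 \<le> \<lambda>\<^sup>\<star> \<le> \<gamma>\<close>) and McDiarmid's inequality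
  give one-sided uniform convergence of the products. The range of \<open>\<lambda>\<^sup>\<star> l(f)\<close> is at most \<open>\<gamma> B\<close> because
  \<open>0 \<le> c\<close> by feasibility, while \<open>c > B\<close> would make every constraint slack and \<open>\<lambda>\<^sup>\<star>\<close> vanish.

  Duality gap: strong convexity makes the tightened convexified dual differentiable, so that its
  maximizer certifies strong duality. Its primal solution is approximated by a predictor of \<open>H\<close>
  that the tightening keeps feasible.
\<close>

section \<open>Bounded differences\<close>

text \<open>The estimator depends on the sample, so its slackness term has to be controlled
  uniformly over \<open>H\<close>. Uniform convergence of \<open>l\<close> as a black box does not
  pass to the products with the multiplier. The form of the rate does: both the Rademacher term and
  the deviation term scale by \<gamma>.

  The obstacle is measurability. \<open>H\<close> may be uncountable, and only suprema of sums with
  weights -1 and 1 are assumed measurable, whereas concentration of the products needs real random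
  weights and an added expectation. Repeated sample points give integer weights and limits give real
  ones. Uniform convergence holds for every distribution, so it also yields fixed points whose
  averages stand in for the expectation.

  For the convexified problem no Slater point is available, so feasibility of its Lagrangian
  minimizer is extracted from dual attainment alone. \<open>H\<close> itself need not be convex: the
  result is carried back by comparing the two dual functions at the tightened multiplier, which
  costs M \<nu> E[\<open>lamtight\<close>], while replacing the convexified solution by a member of
  \<open>H\<close> costs M \<nu>0 in the objective.\<close>

lemma (in prob_space) mgf_le_of_bounded_range:
  fixes g :: "'a \<Rightarrow> real"
  assumes [measurable]: "g \<in> borel_measurable M"
    and bounded: "\<And>y. y \<in> space M \<Longrightarrow> \<bar>g y\<bar> \<le> K"
    and range: "\<And>y y'. y \<in> space M \<Longrightarrow> y' \<in> space M \<Longrightarrow> g y - g y' \<le> c"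
    and s: "0 < s"
  shows "(\<integral>y. exp (s * (g y - expectation g)) \<partial>M) \<le> exp (s\<^sup>2 * c\<^sup>2 / 8)"
proof -
  \<comment> \<open>Hoeffding's lemma wants explicit endpoints. The bound \<open>K\<close> makes
    this infimum finite, and \<open>range\<close> then places all values in an interval of length
    \<open>c\<close> starting at it.\<close>
  define a where "a = (INF y\<in>space M. g y)"
  have ne: "space M \<noteq> {}" by (rule not_empty)
  have bdd: "bdd_below (g ` space M)"
    using bounded by (intro bdd_belowI2[of _ "-K"]) (fastforce dest: bounded)
  have lower: "a \<le> g y" if "y \<in> space M" for y
    unfolding a_def using bdd that by (rule cINF_lower)
  have upper: "g y \<le> a + c" if "y \<in> space M" for y
  proof -
    have "g y - c \<le> a"
      unfolding a_def using ne range[OF that] by (intro cINF_greatest) (auto simp: algebra_simps)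
    thus ?thesis by simp
  qed
  interpret interval_bounded_random_variable M g a "a + c"
    by unfold_locales (auto intro!: AE_I2 lower upper)
  have "(\<integral>\<^sup>+y. ennreal (exp (s * (g y - expectation g))) \<partial>M) \<le> ennreal (exp (s\<^sup>2 * c\<^sup>2 / 8))"
    using Hoeffdings_lemma_nn_integral[OF s] by simp
  thus ?thesis
    by (intro integral_real_bounded) auto
qed

text \<open>Induction on the index set. With the other coordinates frozen, the section in coordinate
  \<open>i\<close> has range at most \<open>c\<close>, so Hoeffding's lemma contributes one factor
  exp(s^2 c^2 / 8). Averaging that coordinate out leaves \<open>T1\<close>, which inherits the
  difference bound. The one-sided hypothesis is enough because it holds at every base point, in
  particular at \<open>x(i := y')\<close>.\<close>

lemma mgf_le_of_bounded_differences:
  fixes D :: "'a measure" and T :: "('i \<Rightarrow> 'a) \<Rightarrow> real" and c :: real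
  assumes D: "prob_space D" and I: "finite I"
    and "T \<in> borel_measurable (Pi\<^sub>M I (\<lambda>_. D))"
    and "\<And>x. x \<in> space (Pi\<^sub>M I (\<lambda>_. D)) \<Longrightarrow> \<bar>T x\<bar> \<le> K"
    and "\<And>x i y. x \<in> space (Pi\<^sub>M I (\<lambda>_. D)) \<Longrightarrow> i \<in> I \<Longrightarrow> y \<in> space D \<Longrightarrow> T (x(i := y)) - T x \<le> c"
    and s: "0 < s"
  shows "(\<integral>x. exp (s * (T x - (\<integral>x. T x \<partial>Pi\<^sub>M I (\<lambda>_. D)))) \<partial>Pi\<^sub>M I (\<lambda>_. D))
           \<le> exp (s\<^sup>2 * c\<^sup>2 * card I / 8)"
  using I assms(3-5)
proof (induction I arbitrary: T)
  case empty
  interpret product_sigma_finite "\<lambda>_. D"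
    by (intro product_sigma_finite.intro prob_space_imp_sigma_finite D)
  show ?case by (simp add: PiM_empty lebesgue_integral_count_space_finite)
next
  case (insert i I)
  interpret D: prob_space D by (rule D)
  interpret PD: product_prob_space "\<lambda>_::'i. D" UNIV by unfold_locales
  let ?P = "Pi\<^sub>M I (\<lambda>_. D)" and ?P' = "Pi\<^sub>M (insert i I) (\<lambda>_. D)"
  interpret P: prob_space ?P by (intro prob_space_PiM D)
  interpret P': prob_space ?P' by (intro prob_space_PiM D)
  note [measurable] = insert.prems(1)
  have upd: "x(i := y) \<in> space ?P'" if "x \<in> space ?P" "y \<in> space D" for x y
    using that by (auto simp: space_PiM PiE_def extensional_def)
  have joint [measurable]: "(\<lambda>(x, y). T (x(i := y))) \<in> borel_measurable (?P \<Otimes>\<^sub>M D)"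
    using measurable_comp[OF measurable_add_dim[of i I "\<lambda>_. D"] insert.prems(1)]
    by (simp add: comp_def case_prod_beta')
  have section_meas: "(\<lambda>y. T (x(i := y))) \<in> borel_measurable D" if "x \<in> space ?P" for x
    using measurable_Pair2[OF joint that] by simp
  define T1 where "T1 x = (\<integral>y. T (x(i := y)) \<partial>D)" for x
  have T1_meas [measurable]: "T1 \<in> borel_measurable ?P"
    unfolding T1_def by (rule D.borel_measurable_lebesgue_integral) (use joint in simp)
  have section_int: "integrable D (\<lambda>y. T (x(i := y)))" if "x \<in> space ?P" for x
    by (rule D.integrable_const_bound[of _ K])
      (use section_meas that insert.prems(2) upd in \<open>auto intro!: AE_I2\<close>)
  have T1_bounded: "\<bar>T1 x\<bar> \<le> K" if "x \<in> space ?P" for x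
  proof -
    have "\<bar>T1 x\<bar> \<le> (\<integral>y. \<bar>T (x(i := y))\<bar> \<partial>D)"
      unfolding T1_def by (rule integral_abs_bound)
    also have "\<dots> \<le> (\<integral>y. K \<partial>D)"
      using that upd insert.prems(2) by (intro integral_mono integrable_abs section_int) auto
    finally show ?thesis by (simp add: D.prob_space)
  qed
  have T1_diff: "T1 (x(j := y)) - T1 x \<le> c" if "x \<in> space ?P" "j \<in> I" "y \<in> space D" for x j y
  proof -
    have x': "x(j := y) \<in> space ?P"
      using that by (auto simp: space_PiM PiE_def extensional_def)
    have "j \<noteq> i" using that insert.hyps by auto
    have "T1 (x(j := y)) - T1 x = (\<integral>v. T ((x(j := y))(i := v)) - T (x(i := v)) \<partial>D)"
      unfolding T1_def using section_int[OF x'] section_int[OF that(1)] by simp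
    also have "\<dots> \<le> (\<integral>v. c \<partial>D)"
    proof (intro integral_mono)
      fix v assume v: "v \<in> space D"
      show "T ((x(j := y))(i := v)) - T (x(i := v)) \<le> c"
        using insert.prems(3)[OF upd[OF that(1) v], of j y] that fun_upd_twist[OF \<open>j \<noteq> i\<close>, of x y v]
        by (simp del: fun_upd_apply)
    qed (use section_int[OF x'] section_int[OF that(1)] in auto)
    finally show ?thesis by (simp add: D.prob_space)
  qed
  have T_int: "integrable ?P' T"
    by (rule P'.integrable_const_bound[of _ K]) (auto intro!: AE_I2 insert.prems(2))
  have mean: "(\<integral>x. T x \<partial>?P') = (\<integral>x. T1 x \<partial>?P)"
    unfolding T1_def by (rule PD.product_integral_insert[OF insert.hyps T_int])
  define m where "m = (\<integral>x. T1 x \<partial>?P)"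
  have exp_bound: "\<bar>exp (s * (u - m))\<bar> \<le> exp (s * (K - m))" if "\<bar>u\<bar> \<le> K" for u
    using that s by auto
  have exp_int: "integrable ?P' (\<lambda>x. exp (s * (T x - m)))"
    by (rule P'.integrable_const_bound[of _ "exp (s * (K - m))"])
      (use exp_bound insert.prems(2) in \<open>auto intro!: AE_I2\<close>)
  have exp_int1: "integrable ?P (\<lambda>x. exp (s * (T1 x - m)))"
    by (rule P.integrable_const_bound[of _ "exp (s * (K - m))"])
      (use exp_bound T1_bounded in \<open>auto intro!: AE_I2\<close>)
  have inner: "(\<integral>y. exp (s * (T (x(i := y)) - m)) \<partial>D)
      \<le> exp (s * (T1 x - m)) * exp (s\<^sup>2 * c\<^sup>2 / 8)" if x: "x \<in> space ?P" for x
  proof -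
    have "(\<integral>y. exp (s * (T (x(i := y)) - m)) \<partial>D)
        = (\<integral>y. exp (s * (T1 x - m)) * exp (s * (T (x(i := y)) - T1 x)) \<partial>D)"
      by (intro Bochner_Integration.integral_cong) (auto simp: algebra_simps simp flip: exp_add)
    also have "\<dots> = exp (s * (T1 x - m)) * (\<integral>y. exp (s * (T (x(i := y)) - T1 x)) \<partial>D)"
      by simp
    also have "(\<integral>y. exp (s * (T (x(i := y)) - T1 x)) \<partial>D) \<le> exp (s\<^sup>2 * c\<^sup>2 / 8)"
      unfolding T1_def
    proof (rule D.mgf_le_of_bounded_range[OF section_meas[OF x], of K])
      fix y y' assume y: "y \<in> space D" "y' \<in> space D"
      show "\<bar>T (x(i := y))\<bar> \<le> K" using insert.prems(2) upd x y by blast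
      show "T (x(i := y)) - T (x(i := y')) \<le> c"
        using insert.prems(3)[OF upd[OF x y(2)], of i y] y by (simp del: fun_upd_apply)
    qed (rule s)
    finally show ?thesis by simp
  qed
  have "(\<integral>x. exp (s * (T x - (\<integral>x. T x \<partial>?P'))) \<partial>?P') = (\<integral>x. exp (s * (T x - m)) \<partial>?P')"
    by (simp add: mean m_def)
  also have "\<dots> = (\<integral>x. (\<integral>y. exp (s * (T (x(i := y)) - m)) \<partial>D) \<partial>?P)"
    by (rule PD.product_integral_insert[OF insert.hyps exp_int])
  also have "\<dots> \<le> (\<integral>x. exp (s * (T1 x - m)) * exp (s\<^sup>2 * c\<^sup>2 / 8) \<partial>?P)"
    by (intro integral_mono' integrable_mult_left exp_int1 inner) auto
  also have "\<dots> = (\<integral>x. exp (s * (T1 x - m)) \<partial>?P) * exp (s\<^sup>2 * c\<^sup>2 / 8)"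
    by simp
  also have "\<dots> \<le> exp (s\<^sup>2 * c\<^sup>2 * card I / 8) * exp (s\<^sup>2 * c\<^sup>2 / 8)"
    unfolding m_def
    by (intro mult_right_mono insert.IH T1_meas T1_bounded T1_diff) auto
  also have "\<dots> = exp (s\<^sup>2 * c\<^sup>2 * card (insert i I) / 8)"
    using insert.hyps by (simp add: algebra_simps add_divide_distrib flip: exp_add)
  finally show ?case .
qed

lemma mcdiarmid_inequality:
  fixes D :: "'a measure" and T :: "('i \<Rightarrow> 'a) \<Rightarrow> real" and c :: real
  assumes D: "prob_space D" and I: "finite I" "I \<noteq> {}"
    and T: "T \<in> borel_measurable (Pi\<^sub>M I (\<lambda>_. D))"
    and bounded: "\<And>x. x \<in> space (Pi\<^sub>M I (\<lambda>_. D)) \<Longrightarrow> \<bar>T x\<bar> \<le> K"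
    and diff: "\<And>x i y. x \<in> space (Pi\<^sub>M I (\<lambda>_. D)) \<Longrightarrow> i \<in> I \<Longrightarrow> y \<in> space D \<Longrightarrow> T (x(i := y)) - T x \<le> c"
    and pos: "0 < c" "0 < t"
  shows "measure (Pi\<^sub>M I (\<lambda>_. D))
      {x \<in> space (Pi\<^sub>M I (\<lambda>_. D)). (\<integral>x. T x \<partial>Pi\<^sub>M I (\<lambda>_. D)) + t \<le> T x}
      \<le> exp (- 2 * t\<^sup>2 / (card I * c\<^sup>2))"
proof -
  let ?P = "Pi\<^sub>M I (\<lambda>_. D)"
  interpret P: prob_space ?P by (intro prob_space_PiM D)
  note [measurable] = T
  define m where "m = (\<integral>x. T x \<partial>?P)"
  have n: "0 < real (card I)" using I by (simp add: card_gt_0_iff)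
  \<comment> \<open>The minimizer of the Chernoff exponent s^2 c^2 n / 8 - s t, where n is the
    number of coordinates.\<close>
  define s where "s = 4 * t / (card I * c\<^sup>2)"
  have s: "0 < s" using pos n by (simp add: s_def)
  have int: "integrable ?P (\<lambda>x. exp (s * (T x - m)))"
  proof (rule P.integrable_const_bound[of _ "exp (s * (K - m))"])
    show "AE x in ?P. norm (exp (s * (T x - m))) \<le> exp (s * (K - m))"
      using s by (intro AE_I2) (auto dest!: bounded)
  qed simp
  have "P.prob {x \<in> space ?P. m + t \<le> T x} = P.prob {x \<in> space ?P. exp (s * t) \<le> exp (s * (T x - m))}"
    using s by (intro arg_cong[of _ _ P.prob]) auto
  also have "\<dots> \<le> (\<integral>x. exp (s * (T x - m)) \<partial>?P) / exp (s * t)"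
    by (intro integral_Markov_inequality_measure[where A = "{}"] int) auto
  also have "\<dots> \<le> exp (s\<^sup>2 * c\<^sup>2 * card I / 8) / exp (s * t)"
    unfolding m_def
    by (intro divide_right_mono mgf_le_of_bounded_differences[OF D I(1) T bounded diff s]) auto
  also have "\<dots> = exp (s\<^sup>2 * c\<^sup>2 * card I / 8 - s * t)"
    by (simp add: exp_diff)
  also have "s\<^sup>2 * c\<^sup>2 * card I / 8 - s * t = - 2 * t\<^sup>2 / (card I * c\<^sup>2)"
    using n pos by (simp add: s_def field_simps power2_eq_square)
  finally show ?thesis by (simp add: m_def)
qed

section \<open>Suprema of weighted sums over a bounded class\<close>

lemma abs_cSUP_diff_le:
  fixes a b :: "'f \<Rightarrow> real"
  assumes "H \<noteq> {}" "bdd_above (a ` H)" "bdd_above (b ` H)"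
    and le: "\<And>f. f \<in> H \<Longrightarrow> \<bar>a f - b f\<bar> \<le> r"
  shows "\<bar>(SUP f\<in>H. a f) - (SUP f\<in>H. b f)\<bar> \<le> r"
proof -
  have "(SUP f\<in>H. a f) \<le> (SUP f\<in>H. b f) + r"
  proof (rule cSUP_least[OF assms(1)])
    fix f assume f: "f \<in> H"
    show "a f \<le> (SUP f\<in>H. b f) + r"
      using cSUP_upper[OF f assms(3)] le[OF f] by linarith
  qed
  moreover have "(SUP f\<in>H. b f) \<le> (SUP f\<in>H. a f) + r"
  proof (rule cSUP_least[OF assms(1)])
    fix f assume f: "f \<in> H"
    show "b f \<le> (SUP f\<in>H. a f) + r"
      using cSUP_upper[OF f assms(2)] le[OF f] by linarith
  qed
  ultimately show ?thesis by linarith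
qed

lemma borel_measurable_uniform_approx:
  fixes F :: "'a \<Rightarrow> real"
  assumes "\<And>m. G m \<in> borel_measurable M"
    and "\<And>m x. x \<in> space M \<Longrightarrow> \<bar>G m x - F x\<bar> \<le> r m"
    and "r \<longlonglongrightarrow> 0"
  shows "F \<in> borel_measurable M"
proof (rule borel_measurable_LIMSEQ_real[OF _ assms(1)])
  fix x assume x: "x \<in> space M"
  have "(\<lambda>m. G m x - F x) \<longlonglongrightarrow> 0"
    by (rule tendsto_rabs_zero_cancel, rule tendsto_sandwich[OF _ _ tendsto_const assms(3)])
      (use assms(2)[OF x] in auto)
  thus "(\<lambda>m. G m x) \<longlonglongrightarrow> F x"
    by (simp add: LIM_zero_iff)
qed

lemma sum_lessThan_add:
  fixes g :: "nat \<Rightarrow> 'a::comm_monoid_add"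
  shows "(\<Sum>n<N + m. g n) = (\<Sum>n<N. g n) + (\<Sum>j<m. g (N + j))"
  by (induction m) (simp_all add: add.assoc)

lemma finite_signs: "finite (signs N)" and signs_nonempty: "signs N \<noteq> {}"
  by (auto simp: signs_def PiE_eq_empty_iff intro!: finite_PiE)

lemma signs_uminus: "s \<in> signs N \<Longrightarrow> (\<lambda>n\<in>{..<N}. - s n) \<in> signs N"
  by (fastforce simp: signs_def PiE_iff)

lemma bij_betw_signs_uminus: "bij_betw (\<lambda>s. \<lambda>n\<in>{..<N}. - s n) (signs N) (signs N)"
  by (rule bij_betw_byWitness[where f' = "\<lambda>s. \<lambda>n\<in>{..<N}. - s n"])
    (auto simp: signs_uminus image_subset_iff fun_eq_iff signs_def PiE_iff extensional_def)

lemma signed_sup_cong: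
  assumes "\<And>n. n < N \<Longrightarrow> w n = w' n" "\<And>n. n < N \<Longrightarrow> S n = S' n"
  shows "signed_sup H h N w S = signed_sup H h N w' S'"
  unfolding signed_sup_def using assms by (intro SUP_cong refl sum.cong) auto

lemma signed_sup_weighted:
  "signed_sup H (\<lambda>f z. a z * h f z) N w S = signed_sup H h N (\<lambda>n. w n * a (S n)) S"
  by (simp add: signed_sup_def mult.assoc)

text \<open>A coordinate of integer weight \<open>k\<close> is \<open>\<bar>k\<bar>\<close> copies of that coordinate, each of weight \<open>sgn k\<close>.\<close>

lemma measurable_signed_sup_int:
  fixes k :: "nat \<Rightarrow> int"
  assumes meas: "\<And>N s. s \<in> signs N \<Longrightarrow> signed_sup H h N s \<in> borel_measurable (Pi\<^sub>M {..<N} (\<lambda>_. Z))"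
  shows "signed_sup H h N (\<lambda>n. of_int (k n)) \<in> borel_measurable (Pi\<^sub>M {..<N} (\<lambda>_. Z))"
proof -
  define ps where "ps = concat (map (\<lambda>n. replicate (nat \<bar>k n\<bar>) n) [0..<N])"
  have ps: "set ps \<subseteq> {..<N}" by (auto simp: ps_def)
  \<comment> \<open>Indices of weight 0 do not occur in \<open>ps\<close>, so the sign that the test
    \<open>0 \<le> k\<close> gives them is never read.\<close>
  define s :: "nat \<Rightarrow> real" where "s = (\<lambda>j\<in>{..<length ps}. if 0 \<le> k (ps ! j) then 1 else - 1)"
  have s: "s \<in> signs (length ps)" by (auto simp: s_def signs_def)
  have sum_copies: "sum_list (map g ps) = (\<Sum>n<N. \<bar>of_int (k n)\<bar> * g n)" for g :: "nat \<Rightarrow> real"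
  proof -
    have "sum_list (map g (concat (map (\<lambda>n. replicate (nat \<bar>k n\<bar>) n) ns)))
        = sum_list (map (\<lambda>n. \<bar>of_int (k n)\<bar> * g n) ns)" for ns
      by (induction ns) (auto simp: sum_list_replicate)
    thus ?thesis
      by (simp add: ps_def interv_sum_list_conv_sum_set_nat atLeast0LessThan)
  qed
  have eq: "signed_sup H h N (\<lambda>n. of_int (k n))
      = (\<lambda>S. signed_sup H h (length ps) s (\<lambda>j\<in>{..<length ps}. S (ps ! j)))"
  proof
    have "(\<Sum>n<N. of_int (k n) * x n) = (\<Sum>j<length ps. s j * x (ps ! j))" for x :: "nat \<Rightarrow> real"
    proof -
      have "(\<Sum>n<N. of_int (k n) * x n)
          = sum_list (map (\<lambda>i. (if 0 \<le> k i then 1 else - 1) * x i) ps)"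
        unfolding sum_copies by (intro sum.cong) auto
      also have "\<dots> = (\<Sum>j<length ps. s j * x (ps ! j))"
        by (simp add: sum_list_sum_nth atLeast0LessThan s_def)
      finally show ?thesis .
    qed
    thus "signed_sup H h N (\<lambda>n. of_int (k n)) S
        = signed_sup H h (length ps) s (\<lambda>j\<in>{..<length ps}. S (ps ! j))" for S
      by (simp add: signed_sup_def)
  qed
  have "(\<lambda>S. \<lambda>j\<in>{..<length ps}. S (ps ! j))
      \<in> measurable (Pi\<^sub>M {..<N} (\<lambda>_. Z)) (Pi\<^sub>M {..<length ps} (\<lambda>_. Z))"
    using ps by (intro measurable_restrict measurable_component_singleton) (auto simp: subset_iff)
  from measurable_compose[OF this meas[OF s]] show ?thesis
    unfolding eq .
qed

locale bounded_class =
  fixes Z :: "'z measure" and H :: "'f set" and h :: "'f \<Rightarrow> 'z \<Rightarrow> real" and K :: real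
  assumes nonempty: "H \<noteq> {}"
    and bounded: "\<And>f z. f \<in> H \<Longrightarrow> z \<in> space Z \<Longrightarrow> \<bar>h f z\<bar> \<le> K"
    and K_nonneg: "0 \<le> K"
begin

lemma abs_weighted_sum_le:
  assumes "f \<in> H" "S \<in> {..<N} \<rightarrow> space Z"
  shows "\<bar>\<Sum>n<N. w n * h f (S n)\<bar> \<le> (\<Sum>n<N. \<bar>w n\<bar>) * K"
proof -
  have "\<bar>\<Sum>n<N. w n * h f (S n)\<bar> \<le> (\<Sum>n<N. \<bar>w n * h f (S n)\<bar>)" by (rule sum_abs)
  also have "\<dots> \<le> (\<Sum>n<N. \<bar>w n\<bar> * K)"
    unfolding abs_mult using assms by (intro sum_mono mult_left_mono bounded) auto
  finally show ?thesis by (simp add: sum_distrib_right)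
qed

lemma bdd_above_weighted_sum:
  assumes "S \<in> {..<N} \<rightarrow> space Z"
  shows "bdd_above ((\<lambda>f. \<Sum>n<N. w n * h f (S n)) ` H)"
  by (rule bdd_aboveI2[of _ _ "(\<Sum>n<N. \<bar>w n\<bar>) * K"]) (rule abs_le_D1[OF abs_weighted_sum_le[OF _ assms]])

lemma weighted_sum_le_signed_sup:
  assumes "f \<in> H" "S \<in> {..<N} \<rightarrow> space Z"
  shows "(\<Sum>n<N. w n * h f (S n)) \<le> signed_sup H h N w S"
  unfolding signed_sup_def using assms by (intro cSUP_upper bdd_above_weighted_sum)

lemma signed_sup_least:
  assumes "\<And>f. f \<in> H \<Longrightarrow> (\<Sum>n<N. w n * h f (S n)) \<le> r"
  shows "signed_sup H h N w S \<le> r"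
  unfolding signed_sup_def using nonempty assms by (rule cSUP_least)

lemma abs_signed_sup_le:
  assumes "S \<in> {..<N} \<rightarrow> space Z"
  shows "\<bar>signed_sup H h N w S\<bar> \<le> (\<Sum>n<N. \<bar>w n\<bar>) * K"
proof (rule abs_leI)
  show "signed_sup H h N w S \<le> (\<Sum>n<N. \<bar>w n\<bar>) * K"
    using abs_weighted_sum_le[OF _ assms] by (intro signed_sup_least) (auto simp: abs_le_iff)
  obtain f where f: "f \<in> H" using nonempty by blast
  show "- signed_sup H h N w S \<le> (\<Sum>n<N. \<bar>w n\<bar>) * K"
    using weighted_sum_le_signed_sup[OF f assms, of w] abs_weighted_sum_le[OF f assms, of w] by linarith
qed

text \<open>For a fixed sample this is a supremum of linear functions of the weights, hence convex
  in them; the contraction argument rests on this.\<close>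

lemma signed_sup_convex:
  assumes S: "S \<in> {..<N} \<rightarrow> space Z" and t: "0 \<le> t" "t \<le> 1"
  shows "signed_sup H h N (\<lambda>n. t * v n + (1 - t) * w n) S
           \<le> t * signed_sup H h N v S + (1 - t) * signed_sup H h N w S"
proof (rule signed_sup_least)
  fix f assume f: "f \<in> H"
  have "(\<Sum>n<N. (t * v n + (1 - t) * w n) * h f (S n))
      = t * (\<Sum>n<N. v n * h f (S n)) + (1 - t) * (\<Sum>n<N. w n * h f (S n))"
    by (simp add: sum_distrib_left sum.distrib sum_subtractf algebra_simps)
  also have "\<dots> \<le> t * signed_sup H h N v S + (1 - t) * signed_sup H h N w S"
    using t by (intro add_mono mult_left_mono weighted_sum_le_signed_sup f S) auto
  finally show "(\<Sum>n<N. (t * v n + (1 - t) * w n) * h f (S n)) \<le> \<dots>" .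
qed

lemma signed_sup_scale:
  assumes S: "S \<in> {..<N} \<rightarrow> space Z" and c: "0 < c"
  shows "signed_sup H h N (\<lambda>n. c * w n) S = c * signed_sup H h N w S"
proof (rule antisym)
  show "signed_sup H h N (\<lambda>n. c * w n) S \<le> c * signed_sup H h N w S"
  proof (rule signed_sup_least)
    fix f assume "f \<in> H"
    thus "(\<Sum>n<N. c * w n * h f (S n)) \<le> c * signed_sup H h N w S"
      using c weighted_sum_le_signed_sup[OF _ S, of f w] by (simp add: mult.assoc flip: sum_distrib_left)
  qed
  have "signed_sup H h N w S \<le> signed_sup H h N (\<lambda>n. c * w n) S / c"
  proof (rule signed_sup_least)
    fix f assume f: "f \<in> H"
    have "c * (\<Sum>n<N. w n * h f (S n)) \<le> signed_sup H h N (\<lambda>n. c * w n) S"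
      using weighted_sum_le_signed_sup[OF f S, of "\<lambda>n. c * w n"]
      by (simp add: sum_distrib_left mult.assoc)
    thus "(\<Sum>n<N. w n * h f (S n)) \<le> signed_sup H h N (\<lambda>n. c * w n) S / c"
      using c by (simp add: field_simps)
  qed
  thus "c * signed_sup H h N w S \<le> signed_sup H h N (\<lambda>n. c * w n) S"
    using c by (simp add: field_simps)
qed

lemma signed_sup_lipschitz:
  assumes S: "S \<in> {..<N} \<rightarrow> space Z"
  shows "\<bar>signed_sup H h N v S - signed_sup H h N w S\<bar> \<le> (\<Sum>n<N. \<bar>v n - w n\<bar>) * K"
  unfolding signed_sup_def
proof (intro abs_cSUP_diff_le nonempty bdd_above_weighted_sum S)
  fix f assume f: "f \<in> H"
  show "\<bar>(\<Sum>n<N. v n * h f (S n)) - (\<Sum>n<N. w n * h f (S n))\<bar> \<le> (\<Sum>n<N. \<bar>v n - w n\<bar>) * K"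
    using abs_weighted_sum_le[OF f S, of "\<lambda>n. v n - w n"]
    by (simp add: left_diff_distrib sum_subtractf)
qed

text \<open>
  The hypothesis only concerns signs; integer weights come from repeated sample points, and
  \<open>\<lfloor>m w\<rfloor> / m \<rightarrow> w\<close> passes to real weights.
\<close>

lemma measurable_signed_sup:
  assumes meas: "\<And>N s. s \<in> signs N \<Longrightarrow> signed_sup H h N s \<in> borel_measurable (Pi\<^sub>M {..<N} (\<lambda>_. Z))"
    and w [measurable]: "\<And>n. n < N \<Longrightarrow> w n \<in> borel_measurable M"
    and S: "S \<in> measurable M (Pi\<^sub>M {..<N} (\<lambda>_. Z))"
  shows "(\<lambda>x. signed_sup H h N (\<lambda>n. w n x) (S x)) \<in> borel_measurable M"
proof (rule borel_measurable_uniform_approx)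
  have S_space: "S x \<in> {..<N} \<rightarrow> space Z" if "x \<in> space M" for x
    using measurable_space[OF S that] by (auto simp: space_PiM)
  let ?k = "\<lambda>m x. \<lambda>n\<in>{..<N}. \<lfloor>real (Suc m) * w n x\<rfloor>"
  let ?I = "{..<N} \<rightarrow>\<^sub>E (UNIV :: int set)"
  fix m
  show "(\<lambda>x. signed_sup H h N (\<lambda>n. of_int (?k m x n)) (S x) / Suc m) \<in> borel_measurable M"
  \<comment> \<open>The rounded weight vector takes values in a countable set. For each fixed value
    the integer case applies, and the countably many pieces are glued.\<close>
  proof (rule borel_measurable_divide[OF measurable_compose_countable'[where I = ?I and g = "?k m"]])
    show "countable ?I" by (intro countable_PiE) auto
    fix k show "(\<lambda>x. signed_sup H h N (\<lambda>n. of_int (k n)) (S x)) \<in> borel_measurable M"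
      by (rule measurable_compose[OF S measurable_signed_sup_int[OF meas]])
  next
    show "?k m \<in> measurable M (count_space ?I)"
    proof (subst measurable_count_space_eq_countable)
      show "countable ?I" by (intro countable_PiE) auto
      have "?k m -` {k} \<inter> space M \<in> sets M" if k: "k \<in> ?I" for k
      proof -
        have "?k m -` {k} \<inter> space M = {x \<in> space M. \<forall>n\<in>{..<N}. \<lfloor>real (Suc m) * w n x\<rfloor> = k n}"
          using k by (auto simp: fun_eq_iff PiE_iff extensional_def)
        also have "\<dots> \<in> sets M" by (intro sets.sets_Collect_finite_All) measurable
        finally show ?thesis .
      qed
      thus "?k m \<in> space M \<rightarrow> ?I \<and> (\<forall>a\<in>?I. ?k m -` {a} \<inter> space M \<in> sets M)"
        by auto
    qed
  qed simp
  fix x assume x: "x \<in> space M"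
  have eq: "signed_sup H h N (\<lambda>n. of_int (?k m x n)) (S x) / Suc m
      = signed_sup H h N (\<lambda>n. of_int \<lfloor>real (Suc m) * w n x\<rfloor> / Suc m) (S x)"
    using signed_sup_scale[OF S_space[OF x], of "1 / Suc m" "\<lambda>n. of_int \<lfloor>real (Suc m) * w n x\<rfloor>"]
    by (simp cong: signed_sup_cong)
  have le: "(\<Sum>n<N. \<bar>of_int \<lfloor>real (Suc m) * w n x\<rfloor> / Suc m - w n x\<bar>) * K
      \<le> (real N * inverse (Suc m)) * K"
  proof (intro mult_right_mono sum_bounded_above[where A = "{..<N}", simplified] K_nonneg)
    fix n
    have "\<bar>of_int \<lfloor>real (Suc m) * w n x\<rfloor> - real (Suc m) * w n x\<bar> / Suc m \<le> 1 / Suc m"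
      by (intro divide_right_mono) linarith+
    moreover have "of_int \<lfloor>real (Suc m) * w n x\<rfloor> / Suc m - w n x
        = (of_int \<lfloor>real (Suc m) * w n x\<rfloor> - real (Suc m) * w n x) / Suc m"
      by (simp add: diff_divide_distrib)
    ultimately show "\<bar>of_int \<lfloor>real (Suc m) * w n x\<rfloor> / Suc m - w n x\<bar> \<le> inverse (Suc m)"
      by (simp add: abs_divide inverse_eq_divide)
  qed
  show "\<bar>signed_sup H h N (\<lambda>n. of_int (?k m x n)) (S x) / Suc m
      - signed_sup H h N (\<lambda>n. w n x) (S x)\<bar> \<le> (real N * inverse (Suc m)) * K"
    unfolding eq by (rule order_trans[OF signed_sup_lipschitz[OF S_space[OF x]] le])
next
  show "(\<lambda>m. (real N * inverse (Suc m)) * K) \<longlonglongrightarrow> 0"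
    by (rule tendsto_mult_left_zero[OF tendsto_mult_right_zero[OF LIMSEQ_inverse_real_of_nat]])
qed

text \<open>
  Weights \<open>c m\<close> at fixed points \<open>X m\<close> stand for expectations \<open>e f\<close> that they approximate uniformly.
\<close>

lemma measurable_signed_sup_add:
  fixes e :: "'f \<Rightarrow> real" and N :: nat and L :: "nat \<Rightarrow> nat"
  assumes meas: "\<And>N s. s \<in> signs N \<Longrightarrow> signed_sup H h N s \<in> borel_measurable (Pi\<^sub>M {..<N} (\<lambda>_. Z))"
    and w [measurable]: "\<And>n. n < N \<Longrightarrow> w n \<in> borel_measurable M"
    and S [measurable]: "S \<in> measurable M (Pi\<^sub>M {..<N} (\<lambda>_. Z))"
    and X: "\<And>m. X m \<in> {..<L m} \<rightarrow> space Z"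
    and approx: "\<And>m f. f \<in> H \<Longrightarrow> \<bar>c m * (\<Sum>j<L m. h f (X m j)) - e f\<bar> \<le> r m"
    and r: "r \<longlonglongrightarrow> 0"
  shows "(\<lambda>x. SUP f\<in>H. e f + (\<Sum>n<N. w n x * h f (S x n))) \<in> borel_measurable M"
proof (rule borel_measurable_uniform_approx[OF _ _ r])
  \<comment> \<open>Random sample and fixed points are concatenated into one sample of length
    \<open>N + L m\<close>; the fixed points, each with weight \<open>c m\<close>, contribute the
    approximation of \<open>e f\<close>.\<close>
  let ?w = "\<lambda>m n x. if n < N then w n x else c m"
  let ?S = "\<lambda>m x. \<lambda>n\<in>{..<N + L m}. if n < N then S x n else X m (n - N)"
  fix m
  have comp: "(\<lambda>x. S x n) \<in> measurable M Z" if "n < N" for n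
    using measurable_compose[OF S measurable_component_singleton[of n]] that by simp
  show "(\<lambda>x. signed_sup H h (N + L m) (\<lambda>n. ?w m n x) (?S m x)) \<in> borel_measurable M"
  proof (rule measurable_signed_sup[OF meas])
    show "?w m n \<in> borel_measurable M" for n by (cases "n < N") auto
    show "?S m \<in> measurable M (Pi\<^sub>M {..<N + L m} (\<lambda>_. Z))"
    proof (rule measurable_restrict)
      fix n assume "n \<in> {..<N + L m}"
      thus "(\<lambda>x. if n < N then S x n else X m (n - N)) \<in> measurable M Z"
        using X[of m] comp by (cases "n < N") (auto intro!: measurable_const)
    qed
  qed
  fix x assume x: "x \<in> space M"
  have Sx: "S x \<in> {..<N} \<rightarrow> space Z"
    using measurable_space[OF S x] by (auto simp: space_PiM)
  have S': "?S m x \<in> {..<N + L m} \<rightarrow> space Z"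
    using Sx X[of m] by (auto simp: Pi_iff)
  have split: "(\<Sum>n<N + L m. ?w m n x * h f (?S m x n))
      = c m * (\<Sum>j<L m. h f (X m j)) + (\<Sum>n<N. w n x * h f (S x n))" for f
  proof -
    have "(\<Sum>n<N + L m. ?w m n x * h f (?S m x n))
        = (\<Sum>n<N. ?w m n x * h f (?S m x n)) + (\<Sum>j<L m. ?w m (N + j) x * h f (?S m x (N + j)))"
      by (rule sum_lessThan_add)
    thus ?thesis by (simp add: sum_distrib_left)
  qed
  show "\<bar>signed_sup H h (N + L m) (\<lambda>n. ?w m n x) (?S m x)
      - (SUP f\<in>H. e f + (\<Sum>n<N. w n x * h f (S x n)))\<bar> \<le> r m"
    unfolding signed_sup_def
  proof (intro abs_cSUP_diff_le nonempty bdd_above_weighted_sum[OF S'])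
    show le: "\<bar>(\<Sum>n<N + L m. ?w m n x * h f (?S m x n)) - (e f + (\<Sum>n<N. w n x * h f (S x n)))\<bar> \<le> r m"
      if "f \<in> H" for f
      unfolding split using approx[OF that, of m] by simp
    show "bdd_above ((\<lambda>f. e f + (\<Sum>n<N. w n x * h f (S x n))) ` H)"
    proof (rule bdd_aboveI2)
      fix f assume f: "f \<in> H"
      show "e f + (\<Sum>n<N. w n x * h f (S x n)) \<le> (\<Sum>n<N + L m. \<bar>?w m n x\<bar>) * K + r m"
        using le[OF f] abs_weighted_sum_le[OF f S', of "\<lambda>n. ?w m n x"] by linarith
    qed
  qed
qed

end

section \<open>Rademacher complexity\<close>

context bounded_class
begin

text \<open>Sign vectors are paired with their flip at \<open>k\<close>. Since \<open>a k\<close>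
  lies in [-g, g], it is a convex combination of g and -g, so the weights for \<open>s\<close> are a
  convex combination of the extreme weights for \<open>s\<close> and for its flip. Convexity bounds
  both members of the pair, and the coefficients \<open>t\<close> and \<open>1 - t\<close> add up to
  1 in the sum.\<close>

lemma sum_signs_contraction_step:
  assumes S: "S \<in> {..<N} \<rightarrow> space Z" and k: "k < N" and g: "0 < g" "\<bar>a k\<bar> \<le> g"
  shows "(\<Sum>s\<in>signs N. signed_sup H h N (\<lambda>n. s n * a n) S)
           \<le> (\<Sum>s\<in>signs N. signed_sup H h N (\<lambda>n. s n * (a(k := g)) n) S)"
proof -
  let ?flip = "\<lambda>s::nat \<Rightarrow> real. s(k := - s k)"
  let ?G = "\<lambda>b s. signed_sup H h N (\<lambda>n. s n * b n) S"
  have flip: "?flip s \<in> signs N" if "s \<in> signs N" for s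
    using that k by (fastforce simp: signs_def PiE_iff extensional_def)
  have flip_sum: "(\<Sum>s\<in>signs N. ?G b (?flip s)) = (\<Sum>s\<in>signs N. ?G b s)" for b
    by (rule sum.reindex_bij_witness[of _ ?flip ?flip]) (use flip in auto)
  \<comment> \<open>Chosen so that t g + (1 - t) (-g) = \<open>a k\<close>.\<close>
  define t where "t = (g + a k) / (2 * g)"
  have t: "0 \<le> t" "t \<le> 1" using g by (auto simp: t_def field_simps abs_le_iff)
  have ak: "a k = (2 * t - 1) * g" using g by (simp add: t_def field_simps)
  have pair: "?G a s + ?G a (?flip s) \<le> ?G (a(k := g)) s + ?G (a(k := g)) (?flip s)" for s
  proof -
    let ?v = "\<lambda>n. s n * (a(k := g)) n" and ?v' = "\<lambda>n. ?flip s n * (a(k := g)) n"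
    have "?G a s = signed_sup H h N (\<lambda>n. t * ?v n + (1 - t) * ?v' n) S"
      by (rule signed_sup_cong) (auto simp: ak algebra_simps)
    also have "\<dots> \<le> t * ?G (a(k := g)) s + (1 - t) * ?G (a(k := g)) (?flip s)"
      by (rule signed_sup_convex[OF S t])
    finally have 1: "?G a s \<le> \<dots>" .
    have "?G a (?flip s) = signed_sup H h N (\<lambda>n. t * ?v' n + (1 - t) * ?v n) S"
      by (rule signed_sup_cong) (auto simp: ak algebra_simps)
    also have "\<dots> \<le> t * ?G (a(k := g)) (?flip s) + (1 - t) * ?G (a(k := g)) s"
      by (rule signed_sup_convex[OF S t])
    finally show ?thesis using 1 by (simp add: algebra_simps)
  qed
  have "2 * (\<Sum>s\<in>signs N. ?G a s) = (\<Sum>s\<in>signs N. ?G a s + ?G a (?flip s))"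
    by (simp only: sum.distrib flip_sum mult_2)
  also have "\<dots> \<le> (\<Sum>s\<in>signs N. ?G (a(k := g)) s + ?G (a(k := g)) (?flip s))"
    by (intro sum_mono pair)
  also have "\<dots> = 2 * (\<Sum>s\<in>signs N. ?G (a(k := g)) s)"
    by (simp only: sum.distrib flip_sum mult_2)
  finally show ?thesis by linarith
qed

text \<open>The multipliers are replaced by \<open>g\<close> one coordinate at a time;
  \<open>?b m\<close> has the first \<open>m\<close> replaced. Multiplication by a number is linear
  in the loss, so no factor beyond \<open>g\<close> is lost.\<close>

lemma sum_signs_contraction:
  assumes S: "S \<in> {..<N} \<rightarrow> space Z" and g: "0 < g" "\<And>n. n < N \<Longrightarrow> \<bar>a n\<bar> \<le> g"
  shows "(\<Sum>s\<in>signs N. signed_sup H h N (\<lambda>n. s n * a n) S)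
           \<le> g * (\<Sum>s\<in>signs N. signed_sup H h N s S)"
proof -
  let ?b = "\<lambda>m n. if n < m then g else a n"
  let ?\<Phi> = "\<lambda>b. \<Sum>s\<in>signs N. signed_sup H h N (\<lambda>n. s n * b n) S"
  have "?\<Phi> a \<le> ?\<Phi> (?b m)" if "m \<le> N" for m
    using that
  proof (induction m)
    case (Suc m)
    have "(?b m)(m := g) = ?b (Suc m)" by (auto simp: fun_eq_iff less_Suc_eq)
    moreover have "?\<Phi> (?b m) \<le> ?\<Phi> ((?b m)(m := g))"
      by (rule sum_signs_contraction_step) (use S Suc.prems g in auto)
    ultimately show ?case using Suc by simp
  qed simp
  from this[of N] have "?\<Phi> a \<le> ?\<Phi> (?b N)" by simp
  also have "\<dots> = (\<Sum>s\<in>signs N. g * signed_sup H h N s S)"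
  proof (intro sum.cong refl)
    fix s
    have "signed_sup H h N (\<lambda>n. s n * ?b N n) S = signed_sup H h N (\<lambda>n. g * s n) S"
      by (rule signed_sup_cong) auto
    also have "\<dots> = g * signed_sup H h N s S"
      by (rule signed_sup_scale[OF S g(1)])
    finally show "signed_sup H h N (\<lambda>n. s n * ?b N n) S = g * signed_sup H h N s S" .
  qed
  finally show ?thesis by (simp add: sum_distrib_left)
qed

end

lemma rademacher_eq_sum:
  "rademacher Q H h N
     = 1 / real N * (\<integral>S. (\<Sum>s\<in>signs N. signed_sup H h N s S) / card (signs N) \<partial>Pi\<^sub>M {..<N} (\<lambda>_. Q))"
  unfolding rademacher_def
  by (subst integral_pmf_of_set) (simp_all add: finite_signs signs_nonempty)

locale rademacher_class = bounded_class Z H h K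
  for Z :: "'z measure" and H :: "'f set" and h K +
  fixes D :: "'z measure"
  assumes prob_D: "prob_space D" and sets_D: "sets D = sets Z"
    and signed_sup_measurable_Z:
      "\<And>N s. s \<in> signs N \<Longrightarrow> signed_sup H h N s \<in> borel_measurable (Pi\<^sub>M {..<N} (\<lambda>_. Z))"
begin

sublocale D: prob_space D by (rule prob_D)

lemma space_D: "space D = space Z"
  by (rule sets_eq_imp_space_eq[OF sets_D])

lemma sets_PiM_D: "sets (Pi\<^sub>M I (\<lambda>_. D)) = sets (Pi\<^sub>M I (\<lambda>_. Z))"
  by (intro sets_PiM_cong refl sets_D)

lemma signed_sup_measurable [measurable]:
  "s \<in> signs N \<Longrightarrow> signed_sup H h N s \<in> borel_measurable (Pi\<^sub>M {..<N} (\<lambda>_. D))"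
  using signed_sup_measurable_Z by (simp cong: measurable_cong_sets add: sets_PiM_D)

lemma sample_in: "S \<in> space (Pi\<^sub>M {..<N} (\<lambda>_. D)) \<Longrightarrow> S \<in> {..<N} \<rightarrow> space Z"
  by (auto simp: space_PiM space_D)

lemma signed_sup_integrable:
  assumes s: "s \<in> signs N"
  shows "integrable (Pi\<^sub>M {..<N} (\<lambda>_. D)) (signed_sup H h N s)"
proof -
  interpret P: prob_space "Pi\<^sub>M {..<N} (\<lambda>_. D)" by (intro prob_space_PiM prob_D)
  show ?thesis
    using abs_signed_sup_le[OF sample_in, of _ N s] s
    by (intro P.integrable_const_bound[of _ "(\<Sum>n<N. \<bar>s n\<bar>) * K"]) (auto intro!: AE_I2)
qed

lemma rademacher_eq_sum_integral:
  "rademacher D H h N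
     = 1 / real N * ((\<Sum>s\<in>signs N. \<integral>S. signed_sup H h N s S \<partial>Pi\<^sub>M {..<N} (\<lambda>_. D)) / card (signs N))"
  unfolding rademacher_eq_sum
  by (simp add: Bochner_Integration.integral_sum signed_sup_integrable)

end

section \<open>Symmetrization and concentration of the one-sided deviation\<close>

context rademacher_class
begin

text \<open>Injectivity keeps the selected coordinates independent with law \<open>D\<close>. It is
  used both for permutations of a doubled sample and for the projections onto its two
  halves.\<close>

lemma integral_reindex:
  fixes F :: "(nat \<Rightarrow> 'z) \<Rightarrow> real" and p :: "nat \<Rightarrow> nat"
  assumes p: "inj_on p {..<N}" "p \<in> {..<N} \<rightarrow> {..<L}"
    and F: "F \<in> borel_measurable (Pi\<^sub>M {..<N} (\<lambda>_. D))"
  shows "(\<integral>X. F (\<lambda>n\<in>{..<N}. X (p n)) \<partial>Pi\<^sub>M {..<L} (\<lambda>_. D)) = (\<integral>S. F S \<partial>Pi\<^sub>M {..<N} (\<lambda>_. D))"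
proof -
  let ?r = "\<lambda>X::nat \<Rightarrow> 'z. \<lambda>n\<in>{..<N}. X (p n)"
  have "?r \<in> measurable (Pi\<^sub>M {..<L} (\<lambda>_. D)) (Pi\<^sub>M {..<N} (\<lambda>_. D))"
    using p(2) by (intro measurable_restrict measurable_component_singleton) auto
  from integral_distr[OF this F] distr_PiM_reindex[OF prob_D p] show ?thesis by simp
qed

lemma reindexed_integrable:
  fixes p :: "nat \<Rightarrow> nat"
  assumes p: "p \<in> {..<N} \<rightarrow> {..<L}" and s: "s \<in> signs N"
  shows "integrable (Pi\<^sub>M {..<L} (\<lambda>_. D)) (\<lambda>X. signed_sup H h N s (\<lambda>n\<in>{..<N}. X (p n)))"
proof -
  interpret P: prob_space "Pi\<^sub>M {..<L} (\<lambda>_. D)" by (intro prob_space_PiM prob_D)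
  have r: "(\<lambda>X. \<lambda>n\<in>{..<N}. X (p n)) \<in> measurable (Pi\<^sub>M {..<L} (\<lambda>_. D)) (Pi\<^sub>M {..<N} (\<lambda>_. D))"
    using p by (intro measurable_restrict measurable_component_singleton) auto
  show ?thesis
  proof (rule P.integrable_const_bound[of _ "(\<Sum>n<N. \<bar>s n\<bar>) * K"])
    show "AE X in Pi\<^sub>M {..<L} (\<lambda>_. D). norm (signed_sup H h N s (\<lambda>n\<in>{..<N}. X (p n))) \<le> (\<Sum>n<N. \<bar>s n\<bar>) * K"
      using abs_signed_sup_le[OF sample_in[OF measurable_space[OF r]]] by (intro AE_I2) simp
  qed (rule measurable_compose[OF r signed_sup_measurable[OF s]])
qed

text \<open>
  Exchanging the \<open>n\<close>-th sample point with the \<open>n\<close>-th ghost point, for each \<open>n\<close> with \<open>s n = -1\<close>,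
  preserves the product measure.
\<close>

lemma ghost_swap:
  assumes s: "s \<in> signs N"
  defines "v \<equiv> \<lambda>j\<in>{..<N + N}. if j < N then - 1 else 1 :: real"
  shows "(\<integral>X. signed_sup H h (N + N) v X \<partial>Pi\<^sub>M {..<N + N} (\<lambda>_. D))
    \<le> (\<integral>S. signed_sup H h N s S \<partial>Pi\<^sub>M {..<N} (\<lambda>_. D))
      + (\<integral>S. signed_sup H h N (\<lambda>n\<in>{..<N}. - s n) S \<partial>Pi\<^sub>M {..<N} (\<lambda>_. D))"
proof -
  define p where "p = (\<lambda>j. if s (if j < N then j else j - N) = - 1 then (if j < N then N + j else j - N) else j)"
  have v: "v \<in> signs (N + N)" by (auto simp: v_def signs_def)
  have p: "inj_on p {..<N + N}" "p \<in> {..<N + N} \<rightarrow> {..<N + N}"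
    by (auto simp: p_def inj_on_def split: if_splits)
  have up: "inj_on (\<lambda>n. N + n) {..<N}" "(\<lambda>n. N + n) \<in> {..<N} \<rightarrow> {..<N + N}" by auto
  have lo: "inj_on (\<lambda>n. n) {..<N}" "(\<lambda>n. n) \<in> {..<N} \<rightarrow> {..<N + N}" by auto
  have s': "(\<lambda>n\<in>{..<N}. - s n) \<in> signs N" by (rule signs_uminus[OF s])
  let ?P = "Pi\<^sub>M {..<N + N} (\<lambda>_. D)"
  let ?U = "\<lambda>X. signed_sup H h N s (\<lambda>n\<in>{..<N}. X (N + n))"
  let ?W = "\<lambda>X. signed_sup H h N (\<lambda>n\<in>{..<N}. - s n) (\<lambda>n\<in>{..<N}. X n)"
  have "(\<integral>X. signed_sup H h (N + N) v X \<partial>?P)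
      = (\<integral>X. signed_sup H h (N + N) v (\<lambda>j\<in>{..<N + N}. X (p j)) \<partial>?P)"
    by (rule integral_reindex[OF p signed_sup_measurable[OF v], symmetric])
  also have "\<dots> \<le> (\<integral>X. ?U X + ?W X \<partial>?P)"
  proof (intro integral_mono Bochner_Integration.integrable_add reindexed_integrable up lo p s s' v)
    fix X assume X: "X \<in> space ?P"
    have upX: "(\<lambda>n\<in>{..<N}. X (N + n)) \<in> {..<N} \<rightarrow> space Z" "(\<lambda>n\<in>{..<N}. X n) \<in> {..<N} \<rightarrow> space Z"
      using sample_in[OF X] by (auto simp: Pi_iff)
    show "signed_sup H h (N + N) v (\<lambda>j\<in>{..<N + N}. X (p j)) \<le> ?U X + ?W X"
    proof (rule signed_sup_least)
      fix f assume f: "f \<in> H"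
      have "(\<Sum>j<N + N. v j * h f ((\<lambda>j\<in>{..<N + N}. X (p j)) j))
          = (\<Sum>n<N. - h f (X (p n)) + h f (X (p (N + n))))"
        by (simp add: sum_lessThan_add v_def sum_subtractf sum_negf)
      also have "\<dots> = (\<Sum>n<N. s n * h f (X (N + n)) + - s n * h f (X n))"
      proof (intro sum.cong refl)
        fix n assume "n \<in> {..<N}"
        moreover from this have "s n = 1 \<or> s n = - 1" using s by (auto simp: signs_def PiE_iff)
        ultimately show "- h f (X (p n)) + h f (X (p (N + n))) = s n * h f (X (N + n)) + - s n * h f (X n)"
          by (auto simp: p_def)
      qed
      also have "\<dots> = (\<Sum>n<N. s n * h f ((\<lambda>n\<in>{..<N}. X (N + n)) n))
          + (\<Sum>n<N. (\<lambda>n\<in>{..<N}. - s n) n * h f ((\<lambda>n\<in>{..<N}. X n) n))"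
        by (simp add: sum.distrib sum_subtractf sum_negf)
      \<comment> \<open>Splitting the supremum over the two halves is the origin of the factor 2 in
        front of the Rademacher complexity.\<close>
      also have "\<dots> \<le> ?U X + ?W X"
        by (intro add_mono weighted_sum_le_signed_sup f upX)
      finally show "(\<Sum>j<N + N. v j * h f ((\<lambda>j\<in>{..<N + N}. X (p j)) j)) \<le> ?U X + ?W X" .
    qed
  qed
  also have "\<dots> = (\<integral>X. ?U X \<partial>?P) + (\<integral>X. ?W X \<partial>?P)"
    by (intro Bochner_Integration.integral_add reindexed_integrable up lo s s')
  also have "(\<integral>X. ?U X \<partial>?P) = (\<integral>S. signed_sup H h N s S \<partial>Pi\<^sub>M {..<N} (\<lambda>_. D))"
    by (rule integral_reindex[OF up signed_sup_measurable[OF s]])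
  also have "(\<integral>X. ?W X \<partial>?P) = (\<integral>S. signed_sup H h N (\<lambda>n\<in>{..<N}. - s n) S \<partial>Pi\<^sub>M {..<N} (\<lambda>_. D))"
    by (rule integral_reindex[OF lo signed_sup_measurable[OF s']])
  finally show ?thesis .
qed

text \<open>Without absolute value: the slackness estimate only needs that expectations do not
  exceed averages by much, and one side is what a Rademacher complexity defined without absolute
  values bounds directly.\<close>

definition deviation :: "nat \<Rightarrow> (nat \<Rightarrow> 'z) \<Rightarrow> real" where
  "deviation N S = (SUP f\<in>H. (\<integral>z. h f z \<partial>D) - 1 / real N * (\<Sum>n<N. h f (S n)))"

lemma abs_deviation_summand_le:
  assumes h_meas: "\<And>f. f \<in> H \<Longrightarrow> h f \<in> borel_measurable Z"
    and f: "f \<in> H" and S: "S \<in> {..<N} \<rightarrow> space Z"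
  shows "\<bar>(\<integral>z. h f z \<partial>D) - 1 / real N * (\<Sum>n<N. h f (S n))\<bar> \<le> 2 * K"
proof -
  have [measurable]: "h f \<in> borel_measurable D"
    using h_meas[OF f] by (simp cong: measurable_cong_sets add: sets_D)
  have "\<bar>\<integral>z. h f z \<partial>D\<bar> \<le> (\<integral>z. \<bar>h f z\<bar> \<partial>D)" by (rule integral_abs_bound)
  also have "\<dots> \<le> (\<integral>z. K \<partial>D)"
    using bounded[OF f] K_nonneg by (intro integral_mono') (auto simp: space_D)
  finally have 1: "\<bar>\<integral>z. h f z \<partial>D\<bar> \<le> K" by (simp add: D.prob_space)
  have "\<bar>\<Sum>n<N. (1 / real N) * h f (S n)\<bar> \<le> (\<Sum>n<N. \<bar>1 / real N\<bar>) * K"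
    by (rule abs_weighted_sum_le[OF f S])
  also have "\<dots> \<le> K" using K_nonneg by simp
  finally show ?thesis using 1 unfolding sum_distrib_left[symmetric] by linarith
qed

lemma deviation_upper:
  assumes h_meas: "\<And>f. f \<in> H \<Longrightarrow> h f \<in> borel_measurable Z"
    and f: "f \<in> H" and S: "S \<in> {..<N} \<rightarrow> space Z"
  shows "(\<integral>z. h f z \<partial>D) - 1 / real N * (\<Sum>n<N. h f (S n)) \<le> deviation N S"
  unfolding deviation_def
  by (intro cSUP_upper f bdd_aboveI2[of _ _ "2 * K"] abs_le_D1[OF abs_deviation_summand_le[OF h_meas _ S]])

lemma abs_deviation_le:
  assumes h_meas: "\<And>f. f \<in> H \<Longrightarrow> h f \<in> borel_measurable Z"
    and S: "S \<in> {..<N} \<rightarrow> space Z"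
  shows "\<bar>deviation N S\<bar> \<le> 2 * K"
proof (rule abs_leI)
  show "deviation N S \<le> 2 * K"
    unfolding deviation_def
    by (intro cSUP_least nonempty abs_le_D1[OF abs_deviation_summand_le[OF h_meas _ S]])
  obtain f where f: "f \<in> H" using nonempty by blast
  show "- deviation N S \<le> 2 * K"
    using deviation_upper[OF h_meas f S] abs_deviation_summand_le[OF h_meas f S] by linarith
qed

text \<open>The expectation of \<open>h f\<close> is an average over an independent ghost sample,
  indexed by \<open>?J\<close>, and the supremum of an integral is at most the integral of the
  supremum. The resulting doubled sum is bounded by the ghost exchange for every sign vector, and
  these bounds are averaged.\<close>

lemma expected_deviation_le:
  assumes h_meas: "\<And>f. f \<in> H \<Longrightarrow> h f \<in> borel_measurable Z"
    and N: "N \<ge> 1"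
    and T: "deviation N \<in> borel_measurable (Pi\<^sub>M {..<N} (\<lambda>_. D))"
  shows "(\<integral>S. deviation N S \<partial>Pi\<^sub>M {..<N} (\<lambda>_. D)) \<le> 2 * rademacher D H h N"
proof -
  let ?I = "{..<N}" and ?J = "{N..<N + N}"
  let ?PI = "Pi\<^sub>M ?I (\<lambda>_. D)" and ?PJ = "Pi\<^sub>M ?J (\<lambda>_. D)" and ?P = "Pi\<^sub>M {..<N + N} (\<lambda>_. D)"
  interpret PI: prob_space ?PI by (intro prob_space_PiM prob_D)
  interpret PJ: prob_space ?PJ by (intro prob_space_PiM prob_D)
  interpret prod: product_sigma_finite "\<lambda>_::nat. D"
    by (intro product_sigma_finite.intro D.sigma_finite_measure_axioms)
  have IJ: "?I \<union> ?J = {..<N + N}" "?I \<inter> ?J = {}" by auto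
  have [measurable]: "h f \<in> borel_measurable D" if "f \<in> H" for f
    using h_meas[OF that] by (simp cong: measurable_cong_sets add: sets_D)
  define v :: "nat \<Rightarrow> real" where "v = (\<lambda>j\<in>{..<N + N}. if j < N then - 1 else 1)"
  have v: "v \<in> signs (N + N)" by (auto simp: v_def signs_def)
  let ?V = "signed_sup H h (N + N) v"
  have merge_space: "merge ?I ?J (S, S') \<in> space ?P" if "S \<in> space ?PI" "S' \<in> space ?PJ" for S S'
    using that by (auto simp: space_PiM merge_def PiE_iff extensional_def)
  have V_bound: "\<bar>?V (merge ?I ?J (S, S'))\<bar> \<le> (\<Sum>n<N + N. \<bar>v n\<bar>) * K"
    if "S \<in> space ?PI" "S' \<in> space ?PJ" for S S'
    by (rule abs_signed_sup_le[OF sample_in[OF merge_space[OF that]]])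
  have joint: "(\<lambda>x. ?V (merge ?I ?J x)) \<in> borel_measurable (?PI \<Otimes>\<^sub>M ?PJ)"
    using measurable_compose[OF measurable_merge[of ?I ?J "\<lambda>_. D"]] signed_sup_measurable[OF v] IJ by simp
  have section_int: "integrable ?PJ (\<lambda>S'. ?V (merge ?I ?J (S, S')))" if "S \<in> space ?PI" for S
    by (rule PJ.integrable_const_bound[of _ "(\<Sum>n<N + N. \<bar>v n\<bar>) * K"])
      (use V_bound that measurable_Pair2[OF joint that] in \<open>auto intro!: AE_I2\<close>)
  define V1 where "V1 S = (\<integral>S'. ?V (merge ?I ?J (S, S')) \<partial>?PJ)" for S
  have V1_meas: "V1 \<in> borel_measurable ?PI"
    unfolding V1_def by (rule PJ.borel_measurable_lebesgue_integral) (use joint in \<open>simp add: case_prod_beta'\<close>)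
  have V1_int: "integrable ?PI V1"
  proof (rule PI.integrable_const_bound[OF _ V1_meas])
    show "AE S in ?PI. norm (V1 S) \<le> (\<Sum>n<N + N. \<bar>v n\<bar>) * K"
    proof (rule AE_I2)
      fix S assume S: "S \<in> space ?PI"
      have "norm (V1 S) \<le> (\<integral>S'. norm (?V (merge ?I ?J (S, S'))) \<partial>?PJ)"
        unfolding V1_def by (rule integral_norm_bound)
      also have "\<dots> \<le> (\<integral>S'. (\<Sum>n<N + N. \<bar>v n\<bar>) * K \<partial>?PJ)"
        using V_bound[OF S] by (intro integral_mono integrable_norm section_int S) auto
      finally show "norm (V1 S) \<le> (\<Sum>n<N + N. \<bar>v n\<bar>) * K" by (simp add: PJ.prob_space)
    qed
  qed
  have ghost: "deviation N S \<le> 1 / real N * V1 S" if S: "S \<in> space ?PI" for S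
    unfolding deviation_def
  proof (rule cSUP_least[OF nonempty])
    fix f assume f: "f \<in> H"
    have h_int: "integrable D (h f)"
      by (rule D.integrable_const_bound[of _ K]) (use bounded f space_D in \<open>auto intro!: AE_I2\<close>)
    have comp: "(\<integral>S'. h f (S' (N + n)) \<partial>?PJ) = (\<integral>z. h f z \<partial>D)"
      "integrable ?PJ (\<lambda>S'. h f (S' (N + n)))" if "n < N" for n
    proof -
      have c: "(\<lambda>S'. S' (N + n)) \<in> measurable ?PJ D" using that by simp
      have d: "distr ?PJ D (\<lambda>S'. S' (N + n)) = D"
        using distr_PiM_component[of ?J "\<lambda>_. D" "N + n"] prob_D that by simp
      show "(\<integral>S'. h f (S' (N + n)) \<partial>?PJ) = (\<integral>z. h f z \<partial>D)"
        using integral_distr[OF c, of "h f"] d f by simp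
      show "integrable ?PJ (\<lambda>S'. h f (S' (N + n)))"
        using integrable_distr[OF c, of "h f"] d h_int by simp
    qed
    have "real N * ((\<integral>z. h f z \<partial>D) - 1 / real N * (\<Sum>n<N. h f (S n)))
        = (\<Sum>n<N. (\<integral>S'. h f (S' (N + n)) \<partial>?PJ) - h f (S n))"
      using N comp by (simp add: sum_subtractf algebra_simps)
    also have "\<dots> = (\<integral>S'. (\<Sum>n<N. h f (S' (N + n)) - h f (S n)) \<partial>?PJ)"
      using comp by (simp add: Bochner_Integration.integral_sum PJ.prob_space)
    also have "\<dots> \<le> V1 S"
      unfolding V1_def
    proof (rule integral_mono[OF _ section_int[OF S]])
      show "integrable ?PJ (\<lambda>S'. \<Sum>n<N. h f (S' (N + n)) - h f (S n))"
        using comp by (intro Bochner_Integration.integrable_sum Bochner_Integration.integrable_diff) auto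
      fix S' assume S': "S' \<in> space ?PJ"
      have "(\<Sum>n<N. h f (S' (N + n)) - h f (S n)) = (\<Sum>j<N + N. v j * h f (merge ?I ?J (S, S') j))"
        by (simp add: sum_lessThan_add v_def merge_def sum_negf sum_subtractf)
      also have "\<dots> \<le> ?V (merge ?I ?J (S, S'))"
        by (rule weighted_sum_le_signed_sup[OF f sample_in[OF merge_space[OF S S']]])
      finally show "(\<Sum>n<N. h f (S' (N + n)) - h f (S n)) \<le> ?V (merge ?I ?J (S, S'))" .
    qed
    finally show "(\<integral>z. h f z \<partial>D) - 1 / real N * (\<Sum>n<N. h f (S n)) \<le> 1 / real N * V1 S"
      using N by (simp add: field_simps)
  qed
  let ?E = "\<lambda>s. \<integral>S. signed_sup H h N s S \<partial>?PI"
  have card: "0 < real (card (signs N))"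
    using finite_signs[of N] signs_nonempty[of N] by (simp add: card_gt_0_iff)
  have V_int: "integrable ?P ?V" by (rule signed_sup_integrable[OF v])
  have "(\<integral>S. deviation N S \<partial>?PI) \<le> (\<integral>S. 1 / real N * V1 S \<partial>?PI)"
  proof (intro integral_mono ghost integrable_mult_right V1_int)
    show "integrable ?PI (deviation N)"
      using abs_deviation_le[OF h_meas sample_in] T
      by (intro PI.integrable_const_bound[of _ "2 * K"]) (auto intro!: AE_I2)
  qed
  also have "\<dots> = 1 / real N * (\<integral>S. V1 S \<partial>?PI)" by simp
  also have "(\<integral>S. V1 S \<partial>?PI) = (\<integral>X. ?V X \<partial>?P)"
    unfolding V1_def using prod.product_integral_fold[of ?I ?J ?V] V_int IJ by simp
  also have "\<dots> \<le> 2 * ((\<Sum>s\<in>signs N. ?E s) / card (signs N))"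
  proof -
    have "card (signs N) * (\<integral>X. ?V X \<partial>?P) = (\<Sum>s\<in>signs N. (\<integral>X. ?V X \<partial>?P))" by simp
    also have "\<dots> \<le> (\<Sum>s\<in>signs N. ?E s + ?E (\<lambda>n\<in>{..<N}. - s n))"
      unfolding v_def by (intro sum_mono ghost_swap)
    \<comment> \<open>Negation permutes the sign vectors, so both families of terms have the same
      sum.\<close>
    also have "\<dots> = 2 * (\<Sum>s\<in>signs N. ?E s)"
      using sum.reindex_bij_betw[OF bij_betw_signs_uminus, of ?E N] by (simp add: sum.distrib)
    finally show ?thesis using card by (simp add: field_simps)
  qed
  finally show ?thesis
    unfolding rademacher_eq_sum_integral by (simp add: divide_right_mono)
qed

text \<open>The range \<open>b\<close> is kept apart from the bound \<open>K\<close> on absolute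
  values: a loss shifted by a threshold may be large in absolute value, but the concentration term
  depends only on how far its values spread.\<close>

lemma one_sided_uniform_convergence:
  assumes h_meas: "\<And>f. f \<in> H \<Longrightarrow> h f \<in> borel_measurable Z"
    and range: "\<And>f z z'. f \<in> H \<Longrightarrow> z \<in> space Z \<Longrightarrow> z' \<in> space Z \<Longrightarrow> h f z - h f z' \<le> b"
    and b: "0 < b" and N: "N \<ge> 1"
    and T: "deviation N \<in> borel_measurable (Pi\<^sub>M {..<N} (\<lambda>_. D))"
    and \<delta>: "0 < \<delta>" "\<delta> < 1"
  shows "with_prob_ge (Pi\<^sub>M {..<N} (\<lambda>_. D)) (1 - \<delta>)
    (\<lambda>S. \<forall>f\<in>H. (\<integral>z. h f z \<partial>D) - 1 / real N * (\<Sum>n<N. h f (S n))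
            \<le> 2 * rademacher D H h N + b * sqrt (ln (2 / \<delta>) / (2 * real N)))"
proof -
  let ?P = "Pi\<^sub>M {..<N} (\<lambda>_. D)"
  interpret P: prob_space ?P by (intro prob_space_PiM prob_D)
  note [measurable] = T
  \<comment> \<open>With differences \<open>b / N\<close>, McDiarmid's exponent at this
    \<open>t\<close> is exactly -ln(2/\<delta>). The failure probability is therefore \<delta>/2;
    the rate is calibrated for two sides.\<close>
  define t where "t = b * sqrt (ln (2 / \<delta>) / (2 * real N))"
  have ln: "0 < ln (2 / \<delta>)" using \<delta> by (intro ln_gt_zero) (simp add: field_simps)
  have t: "0 < t" using b N ln by (simp add: t_def)
  let ?m = "\<integral>S. deviation N S \<partial>?P"
  have upd: "deviation N (S(i := y)) - deviation N S \<le> b / N"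
    if S: "S \<in> space ?P" and i: "i \<in> {..<N}" and y: "y \<in> space D" for S i y
  proof -
    have "deviation N (S(i := y)) \<le> deviation N S + b / N"
      unfolding deviation_def[of _ "S(i := y)"]
    proof (rule cSUP_least[OF nonempty])
      fix f assume f: "f \<in> H"
      have "(\<Sum>n<N. h f (S n)) - (\<Sum>n<N. h f ((S(i := y)) n)) = h f (S i) - h f y"
        using i by (simp add: sum.remove[of "{..<N}" i])
      also have "\<dots> \<le> b"
        using i y sample_in[OF S] by (intro range f) (auto simp: space_D)
      finally have "1 / real N * ((\<Sum>n<N. h f (S n)) - (\<Sum>n<N. h f ((S(i := y)) n))) \<le> 1 / real N * b"
        by (intro mult_left_mono) auto
      thus "(\<integral>z. h f z \<partial>D) - 1 / real N * (\<Sum>n<N. h f ((S(i := y)) n)) \<le> deviation N S + b / N"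
        using deviation_upper[OF h_meas f sample_in[OF S]]
        unfolding right_diff_distrib by simp
    qed
    thus ?thesis by simp
  qed
  have ne: "{..<N} \<noteq> {}" using N by (simp add: lessThan_empty_iff)
  have "P.prob {S \<in> space ?P. ?m + t \<le> deviation N S} \<le> exp (- 2 * t\<^sup>2 / (card {..<N} * (b / N)\<^sup>2))"
    using b N t upd abs_deviation_le[OF h_meas sample_in]
    by (intro mcdiarmid_inequality[OF prob_D _ ne T, of "2 * K"]) auto
  also have "- 2 * t\<^sup>2 / (card {..<N} * (b / N)\<^sup>2) = - ln (2 / \<delta>)"
    using b N ln by (simp add: t_def power_mult_distrib power_divide) (simp add: field_simps power2_eq_square)
  also have "exp (- ln (2 / \<delta>)) = \<delta> / 2"
    using \<delta> by (simp add: exp_minus)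
  also have "\<dots> \<le> \<delta>" using \<delta> by simp
  finally have prob: "P.prob {S \<in> space ?P. ?m + t \<le> deviation N S} \<le> \<delta>" .
  let ?A = "{S \<in> space ?P. deviation N S < ?m + t}"
  show ?thesis
    unfolding with_prob_ge_def
  proof (intro bexI[of _ ?A] conjI ballI)
    have "P.prob ?A = 1 - P.prob {S \<in> space ?P. ?m + t \<le> deviation N S}"
      by (subst P.prob_compl[symmetric]) (auto intro!: arg_cong[of _ _ P.prob])
    thus "1 - \<delta> \<le> P.prob ?A" using prob by simp
    fix S f assume S: "S \<in> ?A" and f: "f \<in> H"
    hence "(\<integral>z. h f z \<partial>D) - 1 / real N * (\<Sum>n<N. h f (S n)) \<le> deviation N S"
      by (intro deviation_upper h_meas f sample_in) auto
    also have "\<dots> \<le> ?m + t" using S by simp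
    also have "\<dots> \<le> 2 * rademacher D H h N + t"
      using expected_deviation_le[OF h_meas N T] by simp
    finally show "(\<integral>z. h f z \<partial>D) - 1 / real N * (\<Sum>n<N. h f (S n))
        \<le> 2 * rademacher D H h N + b * sqrt (ln (2 / \<delta>) / (2 * real N))"
      by (simp add: t_def)
  qed measurable
qed

end

section \<open>Uniform convergence of multiplied losses\<close>

text \<open>Turns a probabilistic statement into the existence of a concrete sample with the
  property.\<close>

lemma with_prob_ge_nonempty:
  assumes "with_prob_ge P p E" "0 < p"
  obtains w where "w \<in> space P" "E w"
proof -
  obtain A where A: "A \<in> sets P" "p \<le> measure P A" "\<forall>w\<in>A. E w"
    using assms(1) by (auto simp: with_prob_ge_def)
  hence "A \<noteq> {}" using assms(2) by auto
  thus ?thesis using A sets.sets_into_space that by blast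
qed

lemma with_prob_ge_mono:
  assumes "with_prob_ge P p E" "\<And>w. w \<in> space P \<Longrightarrow> E w \<Longrightarrow> E' w"
  shows "with_prob_ge P p E'"
  using assms sets.sets_into_space unfolding with_prob_ge_def by blast

lemma rademacher_rate_eq:
  assumes "rademacher_rate Z H h b r" "Q \<in> space (prob_algebra Z)" "N \<ge> 1" "\<delta> \<in> {0<..<1}"
  shows "r Q N \<delta> = 2 * rademacher Q H h N + b * sqrt (ln (2 / \<delta>) / (2 * real N))"
  using assms unfolding rademacher_rate_def by blast

text \<open>Makes the errors of deterministic sample averages vanish along growing sizes. The shift
  by \<open>Suc\<close> avoids size 0, for which the rate formula is not assumed.\<close>

lemma rademacher_rate_tendsto_0:
  assumes "rademacher_rate Z H h b r" "Q \<in> space (prob_algebra Z)" "\<delta> \<in> {0<..<1}"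
  shows "(\<lambda>m. r Q (Suc m) \<delta>) \<longlonglongrightarrow> 0"
proof -
  have R: "rademacher Q H h \<longlonglongrightarrow> 0"
    using assms(1,2) unfolding rademacher_rate_def by blast
  have "(\<lambda>N. ln (2 / \<delta>) / 2 * inverse (real (Suc N))) \<longlonglongrightarrow> 0"
    by (rule tendsto_mult_right_zero[OF LIMSEQ_inverse_real_of_nat])
  moreover have "ln (2 / \<delta>) / 2 * inverse (real (Suc N)) = ln (2 / \<delta>) / (2 * real (Suc N))" for N
    by (simp only: divide_inverse inverse_mult_distrib mult.assoc)
  ultimately have "(\<lambda>N. ln (2 / \<delta>) / (2 * real (Suc N))) \<longlonglongrightarrow> 0"
    by (simp only:)
  hence root: "(\<lambda>N. sqrt (ln (2 / \<delta>) / (2 * real (Suc N)))) \<longlonglongrightarrow> sqrt 0"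
    by (rule tendsto_real_sqrt)
  have "(\<lambda>N. 2 * rademacher Q H h (Suc N) + b * sqrt (ln (2 / \<delta>) / (2 * real (Suc N))))
      \<longlonglongrightarrow> 2 * 0 + b * sqrt 0"
    by (intro tendsto_add tendsto_mult tendsto_const LIMSEQ_Suc[OF R] root)
  moreover have "r Q (Suc N) \<delta>
      = 2 * rademacher Q H h (Suc N) + b * sqrt (ln (2 / \<delta>) / (2 * real (Suc N)))" for N
    by (rule rademacher_rate_eq[OF assms(1,2) _ assms(3)]) simp
  ultimately show ?thesis by (simp only: real_sqrt_zero mult_zero_right add_0_right)
qed

context rademacher_class
begin

text \<open>Contraction is applied for each fixed sample, with the numbers \<open>a (S n)\<close> as
  multipliers, and then integrated. The products enter as a class of their own because their suprema
  must be known to be measurable before integration.\<close>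

lemma rademacher_contraction:
  assumes a: "a \<in> borel_measurable Z" "\<And>z. z \<in> space Z \<Longrightarrow> \<bar>a z\<bar> \<le> g" "0 < g"
    and weighted: "rademacher_class Z H (\<lambda>f z. a z * h f z) K' D"
  shows "rademacher D H (\<lambda>f z. a z * h f z) N \<le> g * rademacher D H h N"
proof -
  interpret W: rademacher_class Z H "\<lambda>f z. a z * h f z" K' D by (rule weighted)
  let ?P = "Pi\<^sub>M {..<N} (\<lambda>_. D)"
  let ?A = "\<integral>S. (\<Sum>s\<in>signs N. signed_sup H (\<lambda>f z. a z * h f z) N s S) / card (signs N) \<partial>?P"
  let ?B = "\<integral>S. (\<Sum>s\<in>signs N. signed_sup H h N s S) / card (signs N) \<partial>?P"
  have "?A \<le> (\<integral>S. g * ((\<Sum>s\<in>signs N. signed_sup H h N s S) / card (signs N)) \<partial>?P)"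
  proof (intro integral_mono integrable_mult_right integrable_divide Bochner_Integration.integrable_sum
      W.signed_sup_integrable signed_sup_integrable)
    fix S assume S: "S \<in> space ?P"
    have "(\<Sum>s\<in>signs N. signed_sup H (\<lambda>f z. a z * h f z) N s S)
        \<le> g * (\<Sum>s\<in>signs N. signed_sup H h N s S)"
      unfolding signed_sup_weighted
      by (rule sum_signs_contraction[OF sample_in[OF S]]) (use a sample_in[OF S] in auto)
    thus "(\<Sum>s\<in>signs N. signed_sup H (\<lambda>f z. a z * h f z) N s S) / card (signs N)
        \<le> g * ((\<Sum>s\<in>signs N. signed_sup H h N s S) / card (signs N))"
      by (simp add: divide_right_mono)
  qed
  also have "\<dots> = g * ?B" by (rule integral_mult_right_zero)
  finally have "1 / real N * ?A \<le> 1 / real N * (g * ?B)"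
    by (intro mult_left_mono) auto
  also have "\<dots> = g * (1 / real N * ?B)" by (rule mult.left_commute)
  finally show ?thesis unfolding rademacher_eq_sum .
qed

text \<open>
  The multiplied expectation is a multiple of the expectation under the distribution of density
  \<open>a / E[a]\<close>, hence a uniform limit of averages over fixed points.
\<close>

lemma weighted_expectation_approx:
  assumes D: "D \<in> space (prob_algebra Z)"
    and h_meas: "\<And>f. f \<in> H \<Longrightarrow> h f \<in> borel_measurable Z"
    and uc: "uniform_convergence Z H h r" and rate: "rademacher_rate Z H h b r"
    and a: "a \<in> borel_measurable Z" "\<And>z. z \<in> space Z \<Longrightarrow> 0 \<le> a z \<and> a z \<le> g"
  obtains X :: "nat \<Rightarrow> nat \<Rightarrow> 'z" and \<rho> c :: "nat \<Rightarrow> real"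
  where "\<And>m. X m \<in> {..<Suc m} \<rightarrow> space Z" "\<rho> \<longlonglongrightarrow> 0"
    "\<And>m f. f \<in> H \<Longrightarrow> \<bar>c m * (\<Sum>j<Suc m. h f (X m j)) - (\<integral>z. a z * h f z \<partial>D)\<bar> \<le> \<rho> m"
proof -
  define C where "C = (\<integral>z. a z \<partial>D)"
  have a_D [measurable]: "a \<in> borel_measurable D"
    using a(1) by (simp cong: measurable_cong_sets add: sets_D)
  have h_D [measurable]: "h f \<in> borel_measurable D" if "f \<in> H" for f
    using h_meas[OF that] by (simp cong: measurable_cong_sets add: sets_D)
  have a_int: "integrable D a"
    by (rule D.integrable_const_bound[of _ g]) (use a(2) space_D in \<open>auto intro!: AE_I2\<close>)
  have C_nonneg: "0 \<le> C"
    unfolding C_def using a(2) by (intro Bochner_Integration.integral_nonneg) (auto simp: space_D)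
  show ?thesis
  proof (cases "C = 0")
    \<comment> \<open>No density can be formed from a multiplier of mean zero. It vanishes almost
      everywhere, so all expectations are 0 and weight 0 at an arbitrary point suffices.\<close>
    case True
    moreover have "AE z in D. 0 \<le> a z" using a(2) by (intro AE_I2) (auto simp: space_D)
    ultimately have "AE z in D. a z = 0"
      using integral_nonneg_eq_0_iff_AE[OF a_int] by (simp add: C_def)
    hence "(\<integral>z. a z * h f z \<partial>D) = 0" if "f \<in> H" for f
      by (intro integral_eq_zero_AE) (auto elim: eventually_mono)
    moreover obtain z where "z \<in> space Z" using D.not_empty space_D by auto
    ultimately show ?thesis by (intro that[of "\<lambda>_ _. z" "\<lambda>_. 0" "\<lambda>_. 0"]) auto
  next
    case False
    hence C: "0 < C" using C_nonneg by simp
    define Q where "Q = density D (\<lambda>z. ennreal (a z / C))"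
    have "(\<integral>\<^sup>+z. ennreal (a z / C) \<partial>D) = ennreal (\<integral>z. a z / C \<partial>D)"
      using a_int a(2) C by (intro nn_integral_eq_integral) (auto simp: space_D)
    also have "\<dots> = 1" using C by (simp add: C_def)
    finally have "prob_space Q"
      unfolding Q_def by (intro prob_spaceI) (simp add: emeasure_density cong: nn_integral_cong)
    hence Q: "Q \<in> space (prob_algebra Z)"
      by (simp add: space_prob_algebra Q_def sets_D)
    have E_Q: "(\<integral>z. h f z \<partial>Q) = (\<integral>z. a z * h f z \<partial>D) / C" if f: "f \<in> H" for f
    proof -
      have "(\<integral>z. h f z \<partial>Q) = (\<integral>z. (a z / C) *\<^sub>R h f z \<partial>D)"
        unfolding Q_def using f a(2) C by (intro integral_density) (auto intro!: AE_I2 simp: space_D)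
      thus ?thesis by simp
    qed
    \<comment> \<open>Here uniform convergence is used for a distribution other than
      \<open>D\<close>. Confidence 1/2 serves only to make the event nonempty.\<close>
    have "\<exists>X. X \<in> {..<Suc m} \<rightarrow> space Z \<and>
        (\<forall>f\<in>H. \<bar>(\<integral>z. h f z \<partial>Q) - 1 / real (Suc m) * (\<Sum>n<Suc m. h f (X n))\<bar> \<le> r Q (Suc m) (1 / 2))" for m
    proof -
      have "with_prob_ge (Pi\<^sub>M {..<Suc m} (\<lambda>_. Q)) (1 - 1 / 2)
          (\<lambda>S. \<forall>f\<in>H. \<bar>(\<integral>z. h f z \<partial>Q) - 1 / real (Suc m) * (\<Sum>n<Suc m. h f (S n))\<bar> \<le> r Q (Suc m) (1 / 2))"
        using uc[unfolded uniform_convergence_def, rule_format, OF Q, of "Suc m" "1 / 2"] by simp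
      then obtain S where S: "S \<in> space (Pi\<^sub>M {..<Suc m} (\<lambda>_. Q))"
          "\<forall>f\<in>H. \<bar>(\<integral>z. h f z \<partial>Q) - 1 / real (Suc m) * (\<Sum>n<Suc m. h f (S n))\<bar> \<le> r Q (Suc m) (1 / 2)"
        by (rule with_prob_ge_nonempty) auto
      have "S \<in> {..<Suc m} \<rightarrow> space Z"
        using S(1) by (auto simp: space_PiM Q_def space_D)
      thus ?thesis using S(2) by blast
    qed
    then obtain X where X: "\<And>m. X m \<in> {..<Suc m} \<rightarrow> space Z"
      and approx: "\<And>m f. f \<in> H \<Longrightarrow>
        \<bar>(\<integral>z. h f z \<partial>Q) - 1 / real (Suc m) * (\<Sum>n<Suc m. h f (X m n))\<bar> \<le> r Q (Suc m) (1 / 2)"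
      by metis
    show ?thesis
    proof (rule that[of X "\<lambda>m. C * r Q (Suc m) (1 / 2)" "\<lambda>m. C / real (Suc m)"])
      show "(\<lambda>m. C * r Q (Suc m) (1 / 2)) \<longlonglongrightarrow> 0"
        by (rule tendsto_mult_right_zero[OF rademacher_rate_tendsto_0[OF rate Q]]) simp
      fix m f assume f: "f \<in> H"
      have "C / real (Suc m) * (\<Sum>j<Suc m. h f (X m j)) - (\<integral>z. a z * h f z \<partial>D)
          = - (C * ((\<integral>z. h f z \<partial>Q) - 1 / real (Suc m) * (\<Sum>n<Suc m. h f (X m n))))"
        using C by (simp add: E_Q[OF f] right_diff_distrib del: sum.lessThan_Suc)
      hence "\<bar>C / real (Suc m) * (\<Sum>j<Suc m. h f (X m j)) - (\<integral>z. a z * h f z \<partial>D)\<bar>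
          = C * \<bar>(\<integral>z. h f z \<partial>Q) - 1 / real (Suc m) * (\<Sum>n<Suc m. h f (X m n))\<bar>"
        using C by (simp add: abs_mult del: sum.lessThan_Suc)
      also have "\<dots> \<le> C * r Q (Suc m) (1 / 2)"
        using C approx[OF f] by (intro mult_left_mono) auto
      finally show "\<bar>C / real (Suc m) * (\<Sum>j<Suc m. h f (X m j)) - (\<integral>z. a z * h f z \<partial>D)\<bar>
          \<le> C * r Q (Suc m) (1 / 2)" .
    qed (rule X)
  qed
qed

text \<open>The rate of the products is exactly \<open>g\<close> times the rate of \<open>h\<close>,
  at the same confidence: contraction scales the complexity by \<open>g\<close>, and the range
  \<open>g * b\<close> scales the deviation term by the same factor.\<close>

lemma weighted_uniform_convergence:
  assumes D: "D \<in> space (prob_algebra Z)"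
    and h_meas: "\<And>f. f \<in> H \<Longrightarrow> h f \<in> borel_measurable Z"
    and uc: "uniform_convergence Z H h r" and rate: "rademacher_rate Z H h b r"
    and a: "a \<in> borel_measurable Z" "\<And>z. z \<in> space Z \<Longrightarrow> 0 \<le> a z \<and> a z \<le> g"
    and range: "\<And>f z z'. f \<in> H \<Longrightarrow> z \<in> space Z \<Longrightarrow> z' \<in> space Z \<Longrightarrow> a z * h f z - a z' * h f z' \<le> g * b"
    and pos: "0 < g" "0 < b" and N: "N \<ge> 1" and \<delta>: "\<delta> \<in> {0<..<1}"
  shows "with_prob_ge (Pi\<^sub>M {..<N} (\<lambda>_. D)) (1 - \<delta>)
    (\<lambda>S. \<forall>f\<in>H. (\<integral>z. a z * h f z \<partial>D) - 1 / real N * (\<Sum>n<N. a (S n) * h f (S n)) \<le> g * r D N \<delta>)"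
proof -
  let ?u = "\<lambda>f z. a z * h f z"
  have comp: "(\<lambda>S. a (S n)) \<in> borel_measurable (Pi\<^sub>M {..<N} (\<lambda>_. Z))" if "n < N" for n and N :: nat
  proof -
    have "(\<lambda>S. S n) \<in> measurable (Pi\<^sub>M {..<N} (\<lambda>_. Z)) Z"
      using that by (intro measurable_component_singleton) simp
    thus ?thesis by (rule measurable_compose[OF _ a(1)])
  qed
  have weighted: "rademacher_class Z H ?u (g * K) D"
  proof
    fix f z assume f: "f \<in> H" and z: "z \<in> space Z"
    show "\<bar>?u f z\<bar> \<le> g * K"
      unfolding abs_mult using a(2)[OF z] pos bounded[OF f z] by (intro mult_mono) auto
  next
    fix N s assume "s \<in> signs N"
    have "(\<lambda>S. signed_sup H h N (\<lambda>n. s n * a (S n)) S) \<in> borel_measurable (Pi\<^sub>M {..<N} (\<lambda>_. Z))"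
    proof (rule measurable_signed_sup)
      show "(\<lambda>S. s n * a (S n)) \<in> borel_measurable (Pi\<^sub>M {..<N} (\<lambda>_. Z))" if "n < N" for n
        by (intro borel_measurable_times borel_measurable_const comp that)
    qed (simp_all add: signed_sup_measurable_Z)
    moreover have "signed_sup H ?u N s = (\<lambda>S. signed_sup H h N (\<lambda>n. s n * a (S n)) S)"
      by (rule ext) (rule signed_sup_weighted)
    ultimately show "signed_sup H ?u N s \<in> borel_measurable (Pi\<^sub>M {..<N} (\<lambda>_. Z))"
      by (simp only:)
  qed (use nonempty pos K_nonneg sets_D in auto)
  interpret W: rademacher_class Z H ?u "g * K" D by (rule weighted)
  obtain X :: "nat \<Rightarrow> nat \<Rightarrow> 'z" and \<rho> c :: "nat \<Rightarrow> real"
    where X: "\<And>m. X m \<in> {..<Suc m} \<rightarrow> space Z" "\<rho> \<longlonglongrightarrow> 0"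
      "\<And>m f. f \<in> H \<Longrightarrow> \<bar>c m * (\<Sum>j<Suc m. h f (X m j)) - (\<integral>z. a z * h f z \<partial>D)\<bar> \<le> \<rho> m"
    by (rule weighted_expectation_approx[OF D h_meas uc rate a], assumption, assumption, rule that)
  \<comment> \<open>The deviation is a supremum of an expectation plus a sum with random weights
    -a(S n)/N, the form whose measurability was established for general real weights.\<close>
  have "W.deviation N \<in> borel_measurable (Pi\<^sub>M {..<N} (\<lambda>_. Z))"
  proof -
    have "(\<lambda>S. SUP f\<in>H. (\<integral>z. a z * h f z \<partial>D) + (\<Sum>n<N. (- (1 / real N) * a (S n)) * h f (S n)))
        \<in> borel_measurable (Pi\<^sub>M {..<N} (\<lambda>_. Z))"
    proof (rule measurable_signed_sup_add[where S = "\<lambda>S. S" and w = "\<lambda>n S. - (1 / real N) * a (S n)"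
          and e = "\<lambda>f. \<integral>z. a z * h f z \<partial>D" and X = X and c = c and r = \<rho> and L = Suc])
      show "(\<lambda>S. - (1 / real N) * a (S n)) \<in> borel_measurable (Pi\<^sub>M {..<N} (\<lambda>_. Z))" if "n < N" for n
        by (intro borel_measurable_times borel_measurable_const comp that)
    qed (simp_all only: signed_sup_measurable_Z X measurable_ident[unfolded id_def])
    moreover have "W.deviation N
        = (\<lambda>S. SUP f\<in>H. (\<integral>z. a z * h f z \<partial>D) + (\<Sum>n<N. (- (1 / real N) * a (S n)) * h f (S n)))"
      unfolding W.deviation_def by (intro ext SUP_cong refl) (simp add: sum_negf sum_divide_distrib)
    ultimately show ?thesis by (simp only:)
  qed
  hence T: "W.deviation N \<in> borel_measurable (Pi\<^sub>M {..<N} (\<lambda>_. D))"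
    by (simp cong: measurable_cong_sets add: sets_PiM_D)
  have uc_u: "with_prob_ge (Pi\<^sub>M {..<N} (\<lambda>_. D)) (1 - \<delta>)
    (\<lambda>S. \<forall>f\<in>H. (\<integral>z. ?u f z \<partial>D) - 1 / real N * (\<Sum>n<N. ?u f (S n))
            \<le> 2 * rademacher D H ?u N + (g * b) * sqrt (ln (2 / \<delta>) / (2 * real N)))"
  proof (rule W.one_sided_uniform_convergence[OF _ range _ N T])
    show "?u f \<in> borel_measurable Z" if "f \<in> H" for f
      using a(1) h_meas[OF that] by (rule borel_measurable_times)
  qed (use pos \<delta> in auto)
  have le: "2 * rademacher D H ?u N + (g * b) * sqrt (ln (2 / \<delta>) / (2 * real N)) \<le> g * r D N \<delta>"
  proof -
    have "rademacher D H ?u N \<le> g * rademacher D H h N"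
      by (rule rademacher_contraction[OF a(1) _ pos(1) weighted]) (simp add: a(2))
    moreover have "r D N \<delta> = 2 * rademacher D H h N + b * sqrt (ln (2 / \<delta>) / (2 * real N))"
      by (rule rademacher_rate_eq[OF rate D N \<delta>])
    ultimately show ?thesis by (simp add: distrib_left)
  qed
  show ?thesis
  proof (rule with_prob_ge_mono[OF uc_u], intro ballI)
    fix S f
    assume "\<forall>f\<in>H. (\<integral>z. ?u f z \<partial>D) - 1 / real N * (\<Sum>n<N. ?u f (S n))
        \<le> 2 * rademacher D H ?u N + (g * b) * sqrt (ln (2 / \<delta>) / (2 * real N))" and "f \<in> H"
    hence "(\<integral>z. ?u f z \<partial>D) - 1 / real N * (\<Sum>n<N. ?u f (S n))
        \<le> 2 * rademacher D H ?u N + (g * b) * sqrt (ln (2 / \<delta>) / (2 * real N))" by (rule bspec)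
    thus "(\<integral>z. ?u f z \<partial>D) - 1 / real N * (\<Sum>n<N. ?u f (S n)) \<le> g * r D N \<delta>"
      using le by (rule order_trans)
  qed
qed

end

section \<open>Predictor classes\<close>

lemma convex_class_hull: "convex_class (convex_class hull H)"
  by (rule hull_in) (auto simp: convex_class_def)

lemma norm_le_sup_norm: "ereal (norm (u x)) \<le> sup_norm u"
  unfolding sup_norm_def by (rule SUP_upper) simp

lemma subset_closed_convex_hull:
  assumes "\<And>\<phi> x. \<phi> \<in> H \<Longrightarrow> \<phi> x \<in> Y"
  shows "H \<subseteq> closed_convex_hull Y H"
proof
  fix \<phi> assume \<phi>: "\<phi> \<in> H"
  have "sup_norm (\<lambda>x. \<phi> x - \<phi> x) = 0" by (simp add: sup_norm_def zero_ereal_def)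
  moreover have "\<phi> \<in> convex_class hull H" using \<phi> hull_subset by fast
  ultimately show "\<phi> \<in> closed_convex_hull Y H"
    unfolding closed_convex_hull_def using assms[OF \<phi>] by force
qed

text \<open>Mixing approximants with the same coefficient gives an error at most the larger of the
  two errors; convexity of \<open>Y\<close> keeps the mixture \<open>Y\<close>-valued.\<close>

lemma convex_class_closed_convex_hull:
  assumes "convex Y"
  shows "convex_class (closed_convex_hull Y H)"
  unfolding convex_class_def
proof (intro ballI)
  fix f g :: "'b \<Rightarrow> 'a" and t :: real
  assume fg: "f \<in> closed_convex_hull Y H" "g \<in> closed_convex_hull Y H" and t: "t \<in> {0..1}"
  have "mix t f g x \<in> Y" for x
    using fg t convexD[OF assms, of "f x" "g x" "1 - t" t] by (simp add: closed_convex_hull_def mix_def)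
  moreover have "\<exists>\<psi>\<in>convex_class hull H. sup_norm (\<lambda>x. mix t f g x - \<psi> x) < ereal e" if "0 < e" for e
  proof -
    obtain f' g' where f': "f' \<in> convex_class hull H" "sup_norm (\<lambda>x. f x - f' x) < ereal e"
      and g': "g' \<in> convex_class hull H" "sup_norm (\<lambda>x. g x - g' x) < ereal e"
      using fg \<open>0 < e\<close> unfolding closed_convex_hull_def by blast
    let ?s = "max (sup_norm (\<lambda>x. f x - f' x)) (sup_norm (\<lambda>x. g x - g' x))"
    have "mix t f' g' \<in> convex_class hull H"
      using convex_class_hull[of H] f' g' t unfolding convex_class_def by blast
    moreover have "sup_norm (\<lambda>x. mix t f g x - mix t f' g' x) \<le> ?s"
      unfolding sup_norm_def[of "\<lambda>x. mix t f g x - mix t f' g' x"]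
    proof (rule SUP_least)
      fix x
      let ?m = "max (norm (f x - f' x)) (norm (g x - g' x))"
      have "mix t f g x - mix t f' g' x = (1 - t) *\<^sub>R (f x - f' x) + t *\<^sub>R (g x - g' x)"
        by (simp add: mix_def algebra_simps)
      hence "norm (mix t f g x - mix t f' g' x) \<le> (1 - t) * norm (f x - f' x) + t * norm (g x - g' x)"
        using t norm_triangle_ineq[of "(1 - t) *\<^sub>R (f x - f' x)" "t *\<^sub>R (g x - g' x)"] by simp
      also have "\<dots> \<le> (1 - t) * ?m + t * ?m"
        using t by (intro add_mono mult_left_mono) auto
      also have "\<dots> = ?m" by (simp add: algebra_simps)
      finally have "ereal (norm (mix t f g x - mix t f' g' x)) \<le> ereal ?m" by (simp only: ereal_less_eq)
      also have "\<dots> \<le> ?s"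
        using norm_le_sup_norm[of "\<lambda>x. f x - f' x" x] norm_le_sup_norm[of "\<lambda>x. g x - g' x" x]
        unfolding ereal_max by (intro max.mono)
      finally show "ereal (norm (mix t f g x - mix t f' g' x)) \<le> ?s" .
    qed
    moreover have "?s < ereal e" using f' g' by simp
    ultimately show ?thesis using le_less_trans by blast
  qed
  ultimately show "mix t f g \<in> closed_convex_hull Y H"
    unfolding closed_convex_hull_def by blast
qed

section \<open>Strong duality from dual attainment\<close>

lemma is_arg_min_iff:
  fixes F :: "'f \<Rightarrow> real"
  shows "is_arg_min F P \<phi> \<longleftrightarrow> P \<phi> \<and> (\<forall>\<psi>. P \<psi> \<longrightarrow> F \<phi> \<le> F \<psi>)"
  by (auto simp: is_arg_min_linorder)

text \<open>A real-valued \<open>INF\<close> is meaningful only for nonempty sets that are bounded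
  below; attainment makes it a genuine minimum.\<close>

lemma dual_fun_eq:
  assumes "is_arg_min (lagrangian D0 D l0 l lam) (\<lambda>\<phi>. \<phi> \<in> C) \<phi>"
  shows "dual_fun D0 D l0 l C lam = lagrangian D0 D l0 l lam \<phi>"
  unfolding dual_fun_def using assms by (intro cInf_eq_minimum) (auto simp: is_arg_min_iff)

text \<open>Instantiated for \<open>H\<close> with \<open>l\<close> and for the convexified class
  with the tightened loss. Convexity is therefore left to the individual lemmas.\<close>

locale constrained_problem =
  fixes Z D0 D :: "('x \<times> 'y::real_normed_vector) measure" and C :: "('x \<Rightarrow> 'y) set"
    and l0 l :: "'y \<Rightarrow> 'y \<Rightarrow> real" and K :: real
  assumes D0_in: "D0 \<in> space (prob_algebra Z)" and D_in: "D \<in> space (prob_algebra Z)"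
    and l0_measurable: "\<And>\<phi>. \<phi> \<in> C \<Longrightarrow> loss_at l0 \<phi> \<in> borel_measurable Z"
    and l_measurable: "\<And>\<phi>. \<phi> \<in> C \<Longrightarrow> loss_at l \<phi> \<in> borel_measurable Z"
    and l0_bounded: "\<And>\<phi> z. \<phi> \<in> C \<Longrightarrow> z \<in> space Z \<Longrightarrow> \<bar>loss_at l0 \<phi> z\<bar> \<le> K"
    and l_bounded: "\<And>\<phi> z. \<phi> \<in> C \<Longrightarrow> z \<in> space Z \<Longrightarrow> \<bar>loss_at l \<phi> z\<bar> \<le> K"
begin

sublocale D0: prob_space D0 using D0_in by (simp add: space_prob_algebra)
sublocale D: prob_space D using D_in by (simp add: space_prob_algebra)

lemma sets_D0: "sets D0 = sets Z" and sets_D: "sets D = sets Z"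
  using D0_in D_in by (auto simp: space_prob_algebra)

lemma space_D0: "space D0 = space Z" and space_D: "space D = space Z"
  using sets_eq_imp_space_eq[OF sets_D0] sets_eq_imp_space_eq[OF sets_D] by auto

lemma l0_measurable_D0: "\<phi> \<in> C \<Longrightarrow> loss_at l0 \<phi> \<in> borel_measurable D0"
  using l0_measurable by (simp cong: measurable_cong_sets add: sets_D0)

lemma l_measurable_D: "\<phi> \<in> C \<Longrightarrow> loss_at l \<phi> \<in> borel_measurable D"
  using l_measurable by (simp cong: measurable_cong_sets add: sets_D)

lemma l0_integrable: "\<phi> \<in> C \<Longrightarrow> integrable D0 (loss_at l0 \<phi>)"
  by (rule D0.integrable_const_bound[of _ K])
    (auto intro!: AE_I2 l0_measurable_D0 simp: l0_bounded space_D0)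

lemma weighted_integrable:
  assumes "\<phi> \<in> C" "integrable D \<mu>"
  shows "integrable D (\<lambda>z. \<mu> z * loss_at l \<phi> z)"
proof (rule Bochner_Integration.integrable_bound[of _ "\<lambda>z. K * \<mu> z"])
  show "AE z in D. norm (\<mu> z * loss_at l \<phi> z) \<le> norm (K * \<mu> z)"
  proof (rule AE_I2)
    fix z assume "z \<in> space D"
    hence "\<bar>loss_at l \<phi> z\<bar> \<le> \<bar>K\<bar>"
      using l_bounded[OF assms(1), of z] by (simp add: space_D)
    from mult_left_mono[OF this abs_ge_zero[of "\<mu> z"]]
    show "norm (\<mu> z * loss_at l \<phi> z) \<le> norm (K * \<mu> z)" by (simp add: abs_mult mult.commute)
  qed
qed (use assms l_measurable_D in \<open>auto intro!: borel_measurable_times\<close>)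

lemma lagrangian_add:
  assumes "\<phi> \<in> C" "integrable D lam" "integrable D \<mu>"
  shows "lagrangian D0 D l0 l (\<lambda>z. lam z + t * \<mu> z) \<phi>
    = lagrangian D0 D l0 l lam \<phi> + t * (\<integral>z. \<mu> z * loss_at l \<phi> z \<partial>D)"
proof -
  have "(\<integral>z. (lam z + t * \<mu> z) * loss_at l \<phi> z \<partial>D)
      = (\<integral>z. lam z * loss_at l \<phi> z + t * (\<mu> z * loss_at l \<phi> z) \<partial>D)"
    by (simp add: distrib_right mult.assoc)
  also have "\<dots> = (\<integral>z. lam z * loss_at l \<phi> z \<partial>D) + t * (\<integral>z. \<mu> z * loss_at l \<phi> z \<partial>D)"
    using assms by (simp add: weighted_integrable)
  finally show ?thesis by (simp add: lagrangian_def)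
qed

text \<open>The minimizer is compared with its midpoint to \<open>\<psi>\<close>. Strong convexity
  at t = 1/2 gains m/8 times the squared sup distance, and minimality of \<open>\<phi>\<close> turns
  half the difference of Lagrangian values into a bound, whence m/4. The convex constraint term does
  not spoil this because the multiplier is nonnegative.\<close>

lemma lagrangian_quadratic_growth:
  assumes conv: "convex_class C" "convex_loss Z C l" "strongly_convex_loss Z C l0"
    and lam: "lam \<in> L1_plus D"
    and min: "is_arg_min (lagrangian D0 D l0 l lam) (\<lambda>\<phi>. \<phi> \<in> C) \<phi>"
  obtains m where "0 < m"
    "\<And>\<psi>. \<psi> \<in> C \<Longrightarrow> \<exists>d\<ge>0. (\<forall>x. norm (\<phi> x - \<psi> x) \<le> d) \<and>
        m * d\<^sup>2 \<le> lagrangian D0 D l0 l lam \<psi> - lagrangian D0 D l0 l lam \<phi>"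
proof -
  obtain m where m: "0 < m" and strong: "\<And>z f g t. z \<in> space Z \<Longrightarrow> f \<in> C \<Longrightarrow> g \<in> C \<Longrightarrow> t \<in> {0..1} \<Longrightarrow>
      ereal (loss_at l0 (mix t f g) z) + ereal (m / 2 * (t * (1 - t))) * (sup_norm (\<lambda>x. f x - g x))\<^sup>2
        \<le> ereal ((1 - t) * loss_at l0 f z + t * loss_at l0 g z)"
    using conv(3) unfolding strongly_convex_loss_def by blast
  let ?L = "lagrangian D0 D l0 l lam"
  have \<phi>: "\<phi> \<in> C" and le: "\<And>\<psi>. \<psi> \<in> C \<Longrightarrow> ?L \<phi> \<le> ?L \<psi>"
    using min by (auto simp: is_arg_min_iff)
  have lam_int: "integrable D lam" and lam_nonneg: "AE z in D. 0 \<le> lam z"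
    using lam by (auto simp: L1_plus_def)
  show ?thesis
  proof (rule that[of "m / 4"])
    fix \<psi> assume \<psi>: "\<psi> \<in> C"
    let ?h = "mix (1 / 2) \<phi> \<psi>" and ?s = "sup_norm (\<lambda>x. \<phi> x - \<psi> x)"
    have half: "(1 / 2 :: real) \<in> {0..1}" by simp
    have h: "?h \<in> C" using conv(1) \<phi> \<psi> half unfolding convex_class_def by blast
    have s_nonneg: "0 \<le> ?s"
      using norm_le_sup_norm[of "\<lambda>x. \<phi> x - \<psi> x"] by (rule order_trans[rotated]) simp
    have half_loss: "ereal (loss_at l0 ?h z) + ereal (m / 8) * ?s\<^sup>2
        \<le> ereal (loss_at l0 \<phi> z / 2 + loss_at l0 \<psi> z / 2)" if "z \<in> space Z" for z
      using strong[OF that \<phi> \<psi> half] by simp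
    obtain z0 where z0: "z0 \<in> space Z" using D0.not_empty space_D0 by auto
    \<comment> \<open>An infinite distance would make the left side of strong convexity infinite,
      against a finite right side.\<close>
    have "?s \<noteq> \<infinity>"
      using half_loss[OF z0] m by (auto simp: power2_eq_square)
    then obtain d where d: "?s = ereal d" using s_nonneg by (cases ?s) auto
    have d_nonneg: "0 \<le> d" using s_nonneg d by simp
    have pointwise: "loss_at l0 ?h z + m / 8 * d\<^sup>2 \<le> loss_at l0 \<phi> z / 2 + loss_at l0 \<psi> z / 2"
      if "z \<in> space Z" for z
      using half_loss[OF that] by (simp add: d power2_eq_square)
    have "risk D0 l0 ?h + m / 8 * d\<^sup>2 = (\<integral>z. loss_at l0 ?h z + m / 8 * d\<^sup>2 \<partial>D0)"
      using l0_integrable[OF h] by (simp add: risk_def D0.prob_space)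
    also have "\<dots> \<le> (\<integral>z. loss_at l0 \<phi> z / 2 + loss_at l0 \<psi> z / 2 \<partial>D0)"
      using pointwise l0_integrable[OF h] l0_integrable[OF \<phi>] l0_integrable[OF \<psi>]
      by (intro integral_mono) (auto simp: space_D0)
    also have "\<dots> = risk D0 l0 \<phi> / 2 + risk D0 l0 \<psi> / 2"
      using l0_integrable[OF \<phi>] l0_integrable[OF \<psi>] by (simp add: risk_def)
    finally have risk: "risk D0 l0 ?h + m / 8 * d\<^sup>2 \<le> risk D0 l0 \<phi> / 2 + risk D0 l0 \<psi> / 2" .
    have convex_l: "loss_at l ?h z \<le> loss_at l \<phi> z / 2 + loss_at l \<psi> z / 2" if "z \<in> space D" for z
      using conv(2) that \<phi> \<psi> half unfolding convex_loss_def space_D by fastforce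
    have "(\<integral>z. lam z * loss_at l ?h z \<partial>D)
        \<le> (\<integral>z. (lam z * loss_at l \<phi> z) / 2 + (lam z * loss_at l \<psi> z) / 2 \<partial>D)"
    proof (rule integral_mono_AE)
      show "AE z in D. lam z * loss_at l ?h z \<le> lam z * loss_at l \<phi> z / 2 + lam z * loss_at l \<psi> z / 2"
        using lam_nonneg AE_space
      proof eventually_elim
        case (elim z)
        from mult_left_mono[OF convex_l[OF elim(2)] elim(1)] show ?case by (simp add: algebra_simps)
      qed
    qed (use weighted_integrable[OF _ lam_int] h \<phi> \<psi> in auto)
    also have "\<dots> = (\<integral>z. lam z * loss_at l \<phi> z \<partial>D) / 2 + (\<integral>z. lam z * loss_at l \<psi> z \<partial>D) / 2"
      using weighted_integrable[OF \<phi> lam_int] weighted_integrable[OF \<psi> lam_int] by simp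
    finally have weighted: "(\<integral>z. lam z * loss_at l ?h z \<partial>D) \<le> \<dots>" .
    have "a + p + e \<le> (b + q) / 2 + (c + r) / 2"
      if "a + e \<le> b / 2 + c / 2" "p \<le> q / 2 + r / 2" for a b c e p q r :: real
      using that by (simp add: field_simps)
    from this[OF risk weighted] have "?L ?h + m / 8 * d\<^sup>2 \<le> ?L \<phi> / 2 + ?L \<psi> / 2"
      unfolding lagrangian_def .
    hence "m / 4 * d\<^sup>2 \<le> ?L \<psi> - ?L \<phi>" using le[OF h] by simp
    moreover have "norm (\<phi> x - \<psi> x) \<le> d" for x
      using norm_le_sup_norm[of "\<lambda>x. \<phi> x - \<psi> x" x] d by simp
    ultimately show "\<exists>d\<ge>0. (\<forall>x. norm (\<phi> x - \<psi> x) \<le> d) \<and> m / 4 * d\<^sup>2 \<le> ?L \<psi> - ?L \<phi>"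
      using d_nonneg by blast
  qed (use m in simp)
qed

text \<open>
  Strong convexity makes the Lagrangian minimizer stable under perturbations of the multiplier, so
  the dual function is differentiable (Danskin): at a maximizer of the dual, the minimizer satisfies
  the first-order conditions, which are feasibility and complementary slackness.
\<close>

lemma dual_maximizer_first_order:
  assumes conv: "convex_class C" "convex_loss Z C l" "strongly_convex_loss Z C l0"
    and lip: "0 \<le> M" "\<And>\<phi> \<psi> z. \<phi> \<in> C \<Longrightarrow> \<psi> \<in> C \<Longrightarrow> z \<in> space Z \<Longrightarrow>
        \<bar>loss_at l \<phi> z - loss_at l \<psi> z\<bar> \<le> M * norm (\<phi> (fst z) - \<psi> (fst z))"
    and attained: "\<forall>lam\<in>L1_plus D. \<exists>\<phi>. is_arg_min (lagrangian D0 D l0 l lam) (\<lambda>\<phi>. \<phi> \<in> C) \<phi>"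
    and max: "is_arg_max (dual_fun D0 D l0 l C) (\<lambda>lam. lam \<in> L1_plus D) lam"
    and min: "is_arg_min (lagrangian D0 D l0 l lam) (\<lambda>\<phi>. \<phi> \<in> C) \<phi>"
    and \<mu>: "integrable D \<mu>" "\<And>t. 0 < t \<Longrightarrow> t \<le> 1 \<Longrightarrow> (\<lambda>z. lam z + t * \<mu> z) \<in> L1_plus D"
  shows "(\<integral>z. \<mu> z * loss_at l \<phi> z \<partial>D) \<le> 0"
proof -
  let ?L = "lagrangian D0 D l0 l"
  have lam: "lam \<in> L1_plus D" and max': "\<And>lam'. lam' \<in> L1_plus D \<Longrightarrow>
      dual_fun D0 D l0 l C lam' \<le> dual_fun D0 D l0 l C lam"
    using max by (auto simp: is_arg_max_linorder)
  have lam_int: "integrable D lam" using lam by (simp add: L1_plus_def)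
  have \<phi>: "\<phi> \<in> C" and le: "\<And>\<psi>. \<psi> \<in> C \<Longrightarrow> ?L lam \<phi> \<le> ?L lam \<psi>"
    using min by (auto simp: is_arg_min_iff)
  obtain m where m: "0 < m" and growth: "\<And>\<psi>. \<psi> \<in> C \<Longrightarrow> \<exists>d\<ge>0. (\<forall>x. norm (\<phi> x - \<psi> x) \<le> d) \<and>
        m * d\<^sup>2 \<le> ?L lam \<psi> - ?L lam \<phi>"
    using lagrangian_quadratic_growth[OF conv lam min] by metis
  \<comment> \<open>A Lipschitz constant, in sup norm, for the directional slackness
    \<open>?I\<close>.\<close>
  define A where "A = M * (\<integral>z. \<bar>\<mu> z\<bar> \<partial>D)"
  have A: "0 \<le> A" unfolding A_def using lip(1) by simp
  let ?I = "\<lambda>\<psi>. \<integral>z. \<mu> z * loss_at l \<psi> z \<partial>D"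
  have I_diff: "?I \<phi> - ?I \<psi> \<le> A * d" if \<psi>: "\<psi> \<in> C" and d: "\<forall>x. norm (\<phi> x - \<psi> x) \<le> d" for \<psi> d
  proof -
    have "?I \<phi> - ?I \<psi> = (\<integral>z. \<mu> z * (loss_at l \<phi> z - loss_at l \<psi> z) \<partial>D)"
      using weighted_integrable[OF \<phi> \<mu>(1)] weighted_integrable[OF \<psi> \<mu>(1)]
      by (simp add: right_diff_distrib)
    also have "\<dots> \<le> (\<integral>z. \<bar>\<mu> z\<bar> * (M * d) \<partial>D)"
    proof (intro integral_mono)
      show "integrable D (\<lambda>z. \<mu> z * (loss_at l \<phi> z - loss_at l \<psi> z))"
        using weighted_integrable[OF \<phi> \<mu>(1)] weighted_integrable[OF \<psi> \<mu>(1)]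
        by (simp add: right_diff_distrib)
      fix z assume z: "z \<in> space D"
      have "\<bar>loss_at l \<phi> z - loss_at l \<psi> z\<bar> \<le> M * norm (\<phi> (fst z) - \<psi> (fst z))"
        using lip(2)[OF \<phi> \<psi>] z space_D by simp
      also have "\<dots> \<le> M * d" using lip(1) d by (intro mult_left_mono) auto
      finally have "\<bar>\<mu> z\<bar> * \<bar>loss_at l \<phi> z - loss_at l \<psi> z\<bar> \<le> \<bar>\<mu> z\<bar> * (M * d)"
        by (rule mult_left_mono) simp
      thus "\<mu> z * (loss_at l \<phi> z - loss_at l \<psi> z) \<le> \<bar>\<mu> z\<bar> * (M * d)"
        unfolding abs_mult[symmetric] by linarith
    qed (use \<mu>(1) in auto)
    also have "\<dots> = A * d" by (simp add: A_def)
    finally show ?thesis .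
  qed
  \<comment> \<open>A quantitative form of differentiation from the right: the perturbed minimizer
    moves by at most t A / m, and its slackness in direction \<open>\<mu>\<close> is nonpositive, so
    \<open>?I \<phi>\<close> is at most A times that displacement.\<close>
  have bound: "?I \<phi> \<le> t * (A\<^sup>2 / m)" if t: "0 < t" "t \<le> 1" for t
  proof -
    let ?lam = "\<lambda>z. lam z + t * \<mu> z"
    obtain \<psi> where min_t: "is_arg_min (?L ?lam) (\<lambda>\<phi>. \<phi> \<in> C) \<psi>"
      using attained \<mu>(2)[OF t] by blast
    have \<psi>: "\<psi> \<in> C" and le_t: "?L ?lam \<psi> \<le> ?L ?lam \<phi>"
      using min_t \<phi> by (auto simp: is_arg_min_iff)
    obtain d where d: "0 \<le> d" "\<forall>x. norm (\<phi> x - \<psi> x) \<le> d" "m * d\<^sup>2 \<le> ?L lam \<psi> - ?L lam \<phi>"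
      using growth[OF \<psi>] by blast
    \<comment> \<open>The left side is the dual value at the perturbed multiplier and the right side
      is the maximal dual value.\<close>
    have "?L lam \<psi> + t * ?I \<psi> \<le> ?L lam \<phi>"
      using max'[OF \<mu>(2)[OF t]] unfolding dual_fun_eq[OF min] dual_fun_eq[OF min_t]
      by (simp add: lagrangian_add[OF \<psi> lam_int \<mu>(1)])
    hence "t * ?I \<psi> \<le> 0" using le[OF \<psi>] by linarith
    hence I_nonpos: "?I \<psi> \<le> 0" using t by (simp add: mult_le_0_iff)
    \<comment> \<open>Quadratic growth at \<open>lam\<close> is played against minimality of
      \<open>\<psi>\<close> for the perturbed Lagrangian; only the perturbation term
      survives.\<close>
    have "m * d\<^sup>2 \<le> t * (?I \<phi> - ?I \<psi>)"
      using d(3) le_t by (simp add: lagrangian_add[OF _ lam_int \<mu>(1)] \<phi> \<psi> algebra_simps)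
    also have "\<dots> \<le> t * (A * d)" using t I_diff[OF \<psi> d(2)] by simp
    finally have "(m * d) * d \<le> (t * A) * d" by (simp add: power2_eq_square mult.assoc)
    hence "m * d \<le> t * A"
      using d(1) t A by (cases "d = 0") (auto simp: mult_le_cancel_right)
    hence "d \<le> t * A / m" using m by (simp add: field_simps)
    hence "A * d \<le> A * (t * A / m)" using A by (rule mult_left_mono)
    thus ?thesis using I_diff[OF \<psi> d(2)] I_nonpos by (simp add: power2_eq_square field_simps)
  qed
  show ?thesis
  proof (rule ccontr)
    assume "\<not> ?I \<phi> \<le> 0"
    hence pos: "0 < ?I \<phi>" by simp
    define k where "k = A\<^sup>2 / m"
    have k: "0 \<le> k" using m by (simp add: k_def)
    define t where "t = min 1 (?I \<phi> / (2 * (k + 1)))"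
    have t: "0 < t" "t \<le> 1" using pos k by (auto simp: t_def)
    have "?I \<phi> \<le> t * k" using bound[OF t] by (simp add: k_def)
    also have "\<dots> \<le> ?I \<phi> / (2 * (k + 1)) * k"
      using k by (intro mult_right_mono) (auto simp: t_def)
    also have "\<dots> < ?I \<phi>" using pos k by (simp add: field_simps add_nonneg_pos)
    finally show False by simp
  qed
qed

text \<open>Two directions of perturbation suffice. Raising the multiplier on the violated set
  forces that set to be null; shrinking the multiplier towards 0 shows that the multiplier term at
  \<open>\<phi>\<close> is nonnegative, so that the risk does not exceed the Lagrangian
  value.\<close>

lemma strong_duality:
  assumes conv: "convex_class C" "convex_loss Z C l" "strongly_convex_loss Z C l0"
    and lip: "0 \<le> M" "\<And>\<phi> \<psi> z. \<phi> \<in> C \<Longrightarrow> \<psi> \<in> C \<Longrightarrow> z \<in> space Z \<Longrightarrow>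
        \<bar>loss_at l \<phi> z - loss_at l \<psi> z\<bar> \<le> M * norm (\<phi> (fst z) - \<psi> (fst z))"
    and attained: "\<forall>lam\<in>L1_plus D. \<exists>\<phi>. is_arg_min (lagrangian D0 D l0 l lam) (\<lambda>\<phi>. \<phi> \<in> C) \<phi>"
    and max: "is_arg_max (dual_fun D0 D l0 l C) (\<lambda>lam. lam \<in> L1_plus D) lam"
  obtains \<phi> where "\<phi> \<in> feasible D l C" "risk D0 l0 \<phi> \<le> dual_fun D0 D l0 l C lam"
proof -
  have lam: "integrable D lam" "AE z in D. 0 \<le> lam z"
    using max by (auto simp: is_arg_max_linorder L1_plus_def)
  then obtain \<phi> where min: "is_arg_min (lagrangian D0 D l0 l lam) (\<lambda>\<phi>. \<phi> \<in> C) \<phi>"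
    using attained by (auto simp: L1_plus_def)
  hence \<phi>: "\<phi> \<in> C" by (simp add: is_arg_min_iff)
  note first_order = dual_maximizer_first_order[OF conv lip attained max min]
  let ?V = "{z \<in> space D. 0 < loss_at l \<phi> z}"
  note [measurable] = l_measurable_D[OF \<phi>]
  have V: "?V \<in> sets D" by measurable
  let ?\<mu> = "\<lambda>z. indicator ?V z :: real"
  have \<mu>_int: "integrable D ?\<mu>" using V by (intro integrable_real_indicator) (auto simp: D.emeasure_eq_measure)
  have "(\<integral>z. ?\<mu> z * loss_at l \<phi> z \<partial>D) \<le> 0"
  proof (rule first_order[OF _ _ _ \<mu>_int])
    fix t :: real assume t: "0 < t" "t \<le> 1"
    have "AE z in D. 0 \<le> lam z + t * ?\<mu> z"
      using lam(2) by eventually_elim (use t in \<open>simp add: indicator_def\<close>)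
    thus "(\<lambda>z. lam z + t * ?\<mu> z) \<in> L1_plus D"
      using lam(1) \<mu>_int by (simp add: L1_plus_def)
  qed
  moreover have nonneg: "0 \<le> ?\<mu> z * loss_at l \<phi> z" for z by (simp add: indicator_def)
  ultimately have "(\<integral>z. ?\<mu> z * loss_at l \<phi> z \<partial>D) = 0"
    using Bochner_Integration.integral_nonneg[of D "\<lambda>z. ?\<mu> z * loss_at l \<phi> z"] by force
  hence "AE z in D. ?\<mu> z * loss_at l \<phi> z = 0"
    using integral_nonneg_eq_0_iff_AE[OF weighted_integrable[OF \<phi> \<mu>_int]] nonneg by simp
  hence "AE z in D. loss_at l \<phi> z \<le> 0"
    using AE_space by eventually_elim (auto simp: indicator_def split: if_splits)
  hence feas: "\<phi> \<in> feasible D l C" using \<phi> by (simp add: feasible_def)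
  have "(\<integral>z. - lam z * loss_at l \<phi> z \<partial>D) \<le> 0"
  proof (rule first_order)
    fix t :: real assume t: "0 < t" "t \<le> 1"
    have "AE z in D. 0 \<le> lam z + t * - lam z"
      using lam(2)
    proof eventually_elim
      case (elim z)
      hence "0 \<le> (1 - t) * lam z" using t by simp
      thus ?case by (simp add: algebra_simps)
    qed
    thus "(\<lambda>z. lam z + t * - lam z) \<in> L1_plus D"
      using lam(1) by (simp add: L1_plus_def)
  qed (use lam(1) in auto)
  hence "risk D0 l0 \<phi> \<le> dual_fun D0 D l0 l C lam"
    unfolding dual_fun_eq[OF min] by (simp add: lagrangian_def)
  with feas show ?thesis by (rule that)
qed

end

section \<open>Probability of sample events\<close>

lemma with_prob_ge_le: "with_prob_ge P p E \<Longrightarrow> p' \<le> p \<Longrightarrow> with_prob_ge P p' E"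
  unfolding with_prob_ge_def by (blast intro: order_trans)

lemma (in prob_space) with_prob_ge_conj:
  assumes "with_prob_ge M (1 - a) E" "with_prob_ge M (1 - b) F"
  shows "with_prob_ge M (1 - (a + b)) (\<lambda>w. E w \<and> F w)"
proof -
  obtain A where A: "A \<in> events" "1 - a \<le> prob A" "\<forall>w\<in>A. E w"
    using assms(1) by (auto simp: with_prob_ge_def)
  obtain B where B: "B \<in> events" "1 - b \<le> prob B" "\<forall>w\<in>B. F w"
    using assms(2) by (auto simp: with_prob_ge_def)
  have "prob (A \<union> B) = prob A + prob (B - A)"
    using A(1) B(1) by (rule finite_measure_Union')
  moreover have "prob (B - A) = prob B - prob (B \<inter> A)"
    using A(1) B(1) by (simp add: finite_measure_Diff')
  moreover have "prob (A \<union> B) \<le> 1" by simp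
  ultimately have "1 - (a + b) \<le> prob (B \<inter> A)" using A(2) B(2) by linarith
  thus ?thesis
    unfolding with_prob_ge_def using A B by (intro bexI[of _ "B \<inter> A"]) auto
qed

text \<open>\<open>1 - 0\<close> rather than \<open>1\<close>, so as to be composable by the previous lemma.\<close>

lemma (in prob_space) with_prob_ge_AE:
  assumes "AE w in M. E w"
  shows "with_prob_ge M (1 - 0) E"
proof -
  obtain A where A: "A \<in> null_sets M" "{w \<in> space M. \<not> E w} \<subseteq> A"
    using assms by (auto simp: eventually_ae_filter)
  have "A \<in> events" "prob A = 0"
    using A(1) by (auto simp: measure_eq_0_null_sets)
  moreover from this have "prob (space M - A) = 1"
    using prob_compl[of A] by simp
  ultimately show ?thesis
    unfolding with_prob_ge_def using A(2) by (intro bexI[of _ "space M - A"]) auto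
qed

text \<open>Only the joint law of a single sample is involved. Objective and constraint samples are
  transported separately and may depend on each other arbitrarily, which includes taking them
  equal.\<close>

lemma (in prob_space) with_prob_ge_sample:
  fixes N :: nat
  assumes N: "N \<ge> 1" and indep: "indep_vars (\<lambda>_. Z) X {..<N}"
    and distr: "\<forall>n<N. distr M Z (X n) = D"
    and E: "with_prob_ge (Pi\<^sub>M {..<N} (\<lambda>_. D)) p E"
  shows "with_prob_ge M p (\<lambda>w. E (\<lambda>n\<in>{..<N}. X n w))"
proof -
  let ?X = "\<lambda>w. \<lambda>n\<in>{..<N}. X n w"
  have rv: "random_variable Z (X n)" if "n \<in> {..<N}" for n
    using indep that unfolding indep_vars_def by blast
  have meas: "?X \<in> measurable M (Pi\<^sub>M {..<N} (\<lambda>_. Z))"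
    by (rule measurable_restrict[OF rv])
  have "{..<N} \<noteq> {}" using N by (simp add: lessThan_empty_iff)
  hence "distr M (Pi\<^sub>M {..<N} (\<lambda>_. Z)) ?X = Pi\<^sub>M {..<N} (\<lambda>n. distr M Z (X n))"
    using indep_vars_iff_distr_eq_PiM'[of "{..<N}" X "\<lambda>_. Z"] rv indep by blast
  also have "\<dots> = Pi\<^sub>M {..<N} (\<lambda>_. D)"
    using distr by (intro PiM_cong) auto
  finally have eq: "distr M (Pi\<^sub>M {..<N} (\<lambda>_. Z)) ?X = Pi\<^sub>M {..<N} (\<lambda>_. D)" .
  obtain A where A: "A \<in> sets (Pi\<^sub>M {..<N} (\<lambda>_. D))" "p \<le> measure (Pi\<^sub>M {..<N} (\<lambda>_. D)) A" "\<forall>S\<in>A. E S"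
    using E by (auto simp: with_prob_ge_def)
  have A': "A \<in> sets (Pi\<^sub>M {..<N} (\<lambda>_. Z))" using A(1) by (simp flip: eq)
  have "measure (Pi\<^sub>M {..<N} (\<lambda>_. D)) A = prob (?X -` A \<inter> space M)"
    using measure_distr[OF meas A'] by (simp add: eq)
  thus ?thesis
    unfolding with_prob_ge_def using A measurable_sets[OF meas A']
    by (intro bexI[of _ "?X -` A \<inter> space M"]) auto
qed

section \<open>Vanishing of the multiplier of a slack constraint\<close>

context constrained_problem
begin

text \<open>Comparison with the zero multiplier: if \<open>\<phi>\<close> minimizes the risk,
  maximality of \<open>lam\<close> makes the integral of \<open>lam\<close> times the loss of
  \<open>\<phi>\<close> nonnegative, although the integrand is nonpositive and vanishes only where
  \<open>lam\<close> does.\<close>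

lemma dual_maximizer_eq_0:
  assumes neg: "\<And>\<phi> z. \<phi> \<in> C \<Longrightarrow> z \<in> space Z \<Longrightarrow> loss_at l \<phi> z < 0"
    and attained: "\<forall>lam\<in>L1_plus D. \<exists>\<phi>. is_arg_min (lagrangian D0 D l0 l lam) (\<lambda>\<phi>. \<phi> \<in> C) \<phi>"
    and max: "is_arg_max (dual_fun D0 D l0 l C) (\<lambda>lam. lam \<in> L1_plus D) lam"
  shows "AE z in D. lam z = 0"
proof -
  have lam: "lam \<in> L1_plus D" "integrable D lam" "AE z in D. 0 \<le> lam z"
    using max by (auto simp: is_arg_max_linorder L1_plus_def)
  have 0: "(\<lambda>_. 0) \<in> L1_plus D" by (simp add: L1_plus_def)
  obtain \<phi> where \<phi>: "is_arg_min (lagrangian D0 D l0 l (\<lambda>_. 0)) (\<lambda>\<phi>. \<phi> \<in> C) \<phi>"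
    using attained 0 by blast
  obtain \<psi> where \<psi>: "is_arg_min (lagrangian D0 D l0 l lam) (\<lambda>\<phi>. \<phi> \<in> C) \<psi>"
    using attained lam(1) by blast
  have "\<phi> \<in> C" using \<phi> by (simp add: is_arg_min_iff)
  note int = weighted_integrable[OF this lam(2)]
  have "risk D0 l0 \<phi> = dual_fun D0 D l0 l C (\<lambda>_. 0)"
    unfolding dual_fun_eq[OF \<phi>] by (simp add: lagrangian_def)
  also have "\<dots> \<le> dual_fun D0 D l0 l C lam"
    using max 0 by (simp add: is_arg_max_linorder)
  also have "\<dots> \<le> lagrangian D0 D l0 l lam \<phi>"
    unfolding dual_fun_eq[OF \<psi>] using \<psi> \<open>\<phi> \<in> C\<close> by (simp add: is_arg_min_iff)
  finally have ge: "0 \<le> (\<integral>z. lam z * loss_at l \<phi> z \<partial>D)" by (simp add: lagrangian_def)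
  have nonneg: "AE z in D. 0 \<le> - (lam z * loss_at l \<phi> z)"
    using lam(3) AE_space
  proof eventually_elim
    case (elim z)
    thus ?case using neg[OF \<open>\<phi> \<in> C\<close>, of z] by (simp add: space_D mult_nonneg_nonpos less_imp_le)
  qed
  have "(\<integral>z. - (lam z * loss_at l \<phi> z) \<partial>D) = 0"
    using integral_nonneg_AE[OF nonneg] ge by simp
  hence "AE z in D. - (lam z * loss_at l \<phi> z) = 0"
    using integral_nonneg_eq_0_iff_AE[OF _ nonneg] int by simp
  thus ?thesis
    using AE_space
  proof eventually_elim
    case (elim z)
    thus ?case using neg[OF \<open>\<phi> \<in> C\<close>, of z] by (auto simp: space_D)
  qed
qed

end

theorem theorem4:
  fixes Z D0 D :: "('x \<times> 'y::real_normed_vector) measure"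
    and Y :: "'y set"
    and f :: "real ^ 'p \<Rightarrow> 'x \<Rightarrow> 'y" and \<Theta> :: "(real ^ 'p) set"
    and H Hhat :: "('x \<Rightarrow> 'y) set"
    and l0 l1 l :: "'y \<Rightarrow> 'y \<Rightarrow> real"
    and B c M \<gamma> \<nu> \<nu>0 \<delta> :: real and N :: nat
    and \<zeta>0 \<zeta> \<zeta>I :: "('x \<times> 'y) measure \<Rightarrow> nat \<Rightarrow> real \<Rightarrow> real"
    and lamstar lamtight :: "'x \<times> 'y \<Rightarrow> real"
    and P :: "'w measure" and z0 z :: "nat \<Rightarrow> 'w \<Rightarrow> 'x \<times> 'y"
    and lamhat :: "'w \<Rightarrow> nat \<Rightarrow> real" and fbar :: "'w \<Rightarrow> 'x \<Rightarrow> 'y"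
  assumes spaces: "convex Y" "space Z = UNIV \<times> Y"
      "D0 \<in> space (prob_algebra Z)" "D \<in> space (prob_algebra Z)"
    and predictors: "H = f ` \<Theta>" "\<forall>\<theta>\<in>\<Theta>. \<forall>x. f \<theta> x \<in> Y" "Hhat = closed_convex_hull Y H"
    and losses: "\<forall>u\<in>Y. \<forall>y\<in>Y. l0 u y \<in> {0..B}" "\<forall>u\<in>Y. \<forall>y\<in>Y. l1 u y \<in> {0..B}"
      "l = (\<lambda>u y. l1 u y - c)"
    and loss_measurable: "\<forall>\<phi>\<in>Hhat. loss_at l0 \<phi> \<in> borel_measurable Z"
      "\<forall>\<phi>\<in>Hhat. loss_at l \<phi> \<in> borel_measurable Z"
    and samples: "N \<ge> 1" "prob_space P"
      "prob_space.indep_vars P (\<lambda>_. Z) z0 {..<N}" "\<forall>n<N. distr P Z (z0 n) = D0"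
      "prob_space.indep_vars P (\<lambda>_. Z) z {..<N}" "\<forall>n<N. distr P Z (z n) = D"
    and uniform_conv:
      "uniform_convergence Z H (loss_at l0) \<zeta>0"
      "uniform_convergence Z H (loss_at l) \<zeta>"
      "uniform_convergence Z H (\<lambda>h w. of_bool (loss_at l h w \<le> 0)) \<zeta>I"
    and rates:
      "rademacher_rate Z H (loss_at l0) B \<zeta>0"
      "rademacher_rate Z H (loss_at l) B \<zeta>"
      "rademacher_rate Z H (\<lambda>h w. of_bool (loss_at l h w \<le> 0)) 1 \<zeta>I"
    and minima_attained:
      "\<exists>h. is_arg_min (risk D0 l0) (\<lambda>h. h \<in> feasible D l H) h"
      "\<forall>lam\<in>L1_plus D. \<exists>h. is_arg_min (lagrangian D0 D l0 l lam) (\<lambda>h. h \<in> H) h"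
      "AE w in P. \<forall>lam\<in>emp_multipliers N.
         \<exists>h. is_arg_min (emp_lagrangian N (\<lambda>n. z0 n w) (\<lambda>n. z n w) l0 l lam) (\<lambda>h. h \<in> H) h"
      "\<exists>\<phi>. is_arg_min (risk D0 l0) (\<lambda>\<phi>. \<phi> \<in> feasible D (tighten (M * \<nu>) l) Hhat) \<phi>"
      "\<forall>lam\<in>L1_plus D.
         \<exists>\<phi>. is_arg_min (lagrangian D0 D l0 (tighten (M * \<nu>) l) lam) (\<lambda>\<phi>. \<phi> \<in> Hhat) \<phi>"
    and dual_attained:
      "is_arg_max (dual_fun D0 D l0 l H) (\<lambda>lam. lam \<in> L1_plus D) lamstar"
      "AE w in P. is_arg_max (emp_dual_fun N (\<lambda>n. z0 n w) (\<lambda>n. z n w) l0 l H)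
         (\<lambda>lam. lam \<in> emp_multipliers N) (lamhat w)"
    and bounded_multiplier: "esssup D (\<lambda>w. ereal \<bar>lamstar w\<bar>) \<le> ereal \<gamma>"
    and convexity: "convex_loss Z Hhat l" "strongly_convex_loss Z Hhat l0"
    and near_universality: "\<nu> \<ge> 0" "\<nu>0 \<ge> 0"
      "\<forall>\<phi>\<in>Hhat. \<exists>\<theta>\<in>\<Theta>.
         (\<integral>\<^sup>+ w. ennreal (norm (\<phi> (fst w) - f \<theta> (fst w))) \<partial>D0) \<le> ennreal \<nu>0 \<and>
         (AE w in D. norm (\<phi> (fst w) - f \<theta> (fst w)) \<le> \<nu>)"
    and lipschitz: "\<forall>y\<in>Y. M-lipschitz_on Y (\<lambda>u. l u y)" "\<forall>y\<in>Y. M-lipschitz_on Y (\<lambda>u. l0 u y)"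
    and tight_dual_attained:
      "is_arg_max (dual_fun D0 D l0 (tighten (M * \<nu>) l) Hhat) (\<lambda>lam. lam \<in> L1_plus D) lamtight"
    and estimator:
      "AE w in P. is_arg_min (emp_risk N (\<lambda>n. z0 n w) l0)
         (\<lambda>h. h \<in> emp_feasible N (\<lambda>n. z n w) l H) (fbar w)"
    and delta: "\<delta> \<in> {0<..<1}"
  shows "with_prob_ge P (1 - 5 * \<delta>) (\<lambda>w.
      \<bar>risk D0 l0 (fbar w) - primal_value D0 D l0 l H\<bar>
        \<le> (M * \<nu> * (\<integral>v. lamtight v \<partial>D) + M * \<nu>0) + 3 * \<zeta>0 D0 N \<delta> + \<gamma> * \<zeta> D N \<delta>
      \<and> measure D {v \<in> space D. loss_at l (fbar w) v \<le> 0} \<ge> 1 - \<zeta>I D N \<delta>)"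
proof -

  \<comment> \<open>Ranges and Lipschitz bounds of the losses on the convexified class\<close>
  interpret P: prob_space P by (rule samples(2))
  have N: "N \<ge> 1" by (rule samples(1))
  have prob_D: "prob_space D" and sets_D: "sets D = sets Z" and space_D: "space D = space Z"
    using spaces(4) sets_eq_imp_space_eq by (auto simp: space_prob_algebra)
  interpret D: prob_space D by (rule prob_D)
  have H_Y: "\<phi> x \<in> Y" if "\<phi> \<in> H" for \<phi> x using that predictors by auto
  have H_sub: "H \<subseteq> Hhat" unfolding predictors(3) by (rule subset_closed_convex_hull) (rule H_Y)
  have Hhat_Y: "\<phi> x \<in> Y" if "\<phi> \<in> Hhat" for \<phi> x
    using that by (simp add: predictors(3) closed_convex_hull_def)
  have Hhat_convex: "convex_class Hhat"
    unfolding predictors(3) by (rule convex_class_closed_convex_hull[OF spaces(1)])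
  have snd_Y: "snd v \<in> Y" if "v \<in> space Z" for v
    using that unfolding spaces(2) by (simp add: mem_Times_iff)
  obtain v0 where v0: "v0 \<in> space Z" using D.not_empty unfolding space_D by blast
  have M: "0 \<le> M" by (rule lipschitz_on_nonneg[OF bspec[OF lipschitz(1) snd_Y[OF v0]]])
  have l0_range: "0 \<le> loss_at l0 \<phi> v" "loss_at l0 \<phi> v \<le> B" if "\<phi> \<in> Hhat" "v \<in> space Z" for \<phi> v
    using losses(1) Hhat_Y[OF that(1)] snd_Y[OF that(2)] by (auto simp: loss_at_def)
  have l_range: "- c \<le> loss_at l \<phi> v" "loss_at l \<phi> v \<le> B - c" if "\<phi> \<in> Hhat" "v \<in> space Z" for \<phi> v
    using losses(2) Hhat_Y[OF that(1)] snd_Y[OF that(2)] by (auto simp: loss_at_def losses(3))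
  have lip_l: "\<bar>loss_at l \<phi> v - loss_at l \<psi> v\<bar> \<le> M * norm (\<phi> (fst v) - \<psi> (fst v))"
    and lip_l0: "\<bar>loss_at l0 \<phi> v - loss_at l0 \<psi> v\<bar> \<le> M * norm (\<phi> (fst v) - \<psi> (fst v))"
    if "\<phi> \<in> Hhat" "\<psi> \<in> Hhat" "v \<in> space Z" for \<phi> \<psi> v
    using lipschitz_onD[OF bspec[OF lipschitz(1) snd_Y[OF that(3)]] Hhat_Y[OF that(1)] Hhat_Y[OF that(2)], of "fst v" "fst v"]
      lipschitz_onD[OF bspec[OF lipschitz(2) snd_Y[OF that(3)]] Hhat_Y[OF that(1)] Hhat_Y[OF that(2)], of "fst v" "fst v"]
    by (simp_all add: loss_at_def dist_real_def dist_norm)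
  have tight: "loss_at (tighten k l) \<phi> v = loss_at l \<phi> v + k" for k \<phi> v
    by (simp add: loss_at_def tighten_def)
  have tight_fun: "loss_at (tighten k l) \<phi> = (\<lambda>v. loss_at l \<phi> v + k)" for k \<phi>
    by (rule ext) (rule tight)

  \<comment> \<open>The original and the tightened convexified problem\<close>
  interpret H: constrained_problem Z D0 D H l0 l "B + \<bar>c\<bar>"
  proof
    fix \<phi> v assume "\<phi> \<in> H" "v \<in> space Z"
    thus "\<bar>loss_at l0 \<phi> v\<bar> \<le> B + \<bar>c\<bar>" "\<bar>loss_at l \<phi> v\<bar> \<le> B + \<bar>c\<bar>"
      using l0_range[of \<phi> v] l_range[of \<phi> v] H_sub by auto
  qed (use spaces loss_measurable H_sub in auto)
  interpret T: constrained_problem Z D0 D Hhat l0 "tighten (M * \<nu>) l" "B + \<bar>c\<bar> + \<bar>M * \<nu>\<bar>"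
  proof
    fix \<phi> v assume "\<phi> \<in> Hhat" "v \<in> space Z"
    thus "\<bar>loss_at l0 \<phi> v\<bar> \<le> B + \<bar>c\<bar> + \<bar>M * \<nu>\<bar>"
        "\<bar>loss_at (tighten (M * \<nu>) l) \<phi> v\<bar> \<le> B + \<bar>c\<bar> + \<bar>M * \<nu>\<bar>"
      using l0_range[of \<phi> v] l_range[of \<phi> v] unfolding tight by linarith+
  qed (use spaces loss_measurable in \<open>auto simp: tight_fun\<close>)

  have lamstar: "lamstar \<in> L1_plus D" "integrable D lamstar" "AE v in D. 0 \<le> lamstar v"
    using dual_attained(1) by (auto simp: is_arg_max_linorder L1_plus_def)
  have lamtight: "lamtight \<in> L1_plus D" "integrable D lamtight" "AE v in D. 0 \<le> lamtight v"
    using tight_dual_attained by (auto simp: is_arg_max_linorder L1_plus_def)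
  obtain fstar where fstar: "fstar \<in> feasible D l H"
      "\<And>h. h \<in> feasible D l H \<Longrightarrow> risk D0 l0 fstar \<le> risk D0 l0 h"
    using minima_attained(1) by (auto simp: is_arg_min_iff)
  have P_star: "primal_value D0 D l0 l H = risk D0 l0 fstar"
    unfolding primal_value_def using fstar by (intro cInf_eq_minimum) auto
  have fstar_H: "fstar \<in> H" and fstar_feas: "AE v in D. loss_at l fstar v \<le> 0"
    using fstar(1) by (auto simp: feasible_def)
  define \<Delta> where "\<Delta> = M * \<nu> * (\<integral>v. lamtight v \<partial>D) + M * \<nu>0"
  have \<Delta>: "0 \<le> \<Delta>"
    unfolding \<Delta>_def using M near_universality(1,2) lamtight(3)
    by (intro add_nonneg_nonneg mult_nonneg_nonneg integral_nonneg_AE) auto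

  \<comment> \<open>The duality gap\<close>
  have gap: "risk D0 l0 fstar \<le> dual_fun D0 D l0 l H lamstar + \<Delta>"
  proof -
    have "convex_loss Z Hhat (tighten (M * \<nu>) l)"
      using convexity(1) unfolding convex_loss_def tight by (simp add: algebra_simps)
    from T.strong_duality[OF Hhat_convex this convexity(2) M _ minima_attained(5) tight_dual_attained]
    obtain \<phi> where \<phi>: "\<phi> \<in> feasible D (tighten (M * \<nu>) l) Hhat"
        "risk D0 l0 \<phi> \<le> dual_fun D0 D l0 (tighten (M * \<nu>) l) Hhat lamtight"
      using lip_l by (auto simp: tight)
    have \<phi>_H: "\<phi> \<in> Hhat" and \<phi>_feas: "AE v in D. loss_at l \<phi> v + M * \<nu> \<le> 0"
      using \<phi>(1) by (auto simp: feasible_def tight)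
    obtain \<theta> where \<theta>: "\<theta> \<in> \<Theta>"
        "(\<integral>\<^sup>+ v. ennreal (norm (\<phi> (fst v) - f \<theta> (fst v))) \<partial>D0) \<le> ennreal \<nu>0"
        "AE v in D. norm (\<phi> (fst v) - f \<theta> (fst v)) \<le> \<nu>"
      using near_universality(3) \<phi>_H by blast
    have f_H: "f \<theta> \<in> H" using \<theta>(1) predictors(1) by simp
    hence f_Hhat: "f \<theta> \<in> Hhat" using H_sub by blast
    have "AE v in D. loss_at l (f \<theta>) v \<le> 0"
      using \<theta>(3) \<phi>_feas AE_space
    proof eventually_elim
      case (elim v)
      have "loss_at l (f \<theta>) v - loss_at l \<phi> v \<le> M * norm (\<phi> (fst v) - f \<theta> (fst v))"
        using lip_l[OF \<phi>_H f_Hhat, of v] elim(3) by (simp add: space_D abs_le_iff)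
      also have "\<dots> \<le> M * \<nu>" using elim(1) M by (rule mult_left_mono)
      finally show ?case using elim(2) by linarith
    qed
    hence "f \<theta> \<in> feasible D l H" using f_H by (simp add: feasible_def)
    hence "risk D0 l0 fstar \<le> risk D0 l0 (f \<theta>)" by (rule fstar(2))
    also have "\<dots> \<le> risk D0 l0 \<phi> + M * \<nu>0"
    \<comment> \<open>The distance between the predictors need not be measurable. The loss
      difference divided by \<open>M\<close> is measurable and pointwise below it, so the comparison
      uses only monotonicity of the nonnegative integral; this requires M to be nonzero.\<close>
    proof (cases "M = 0")
      case True
      hence "loss_at l0 (f \<theta>) v = loss_at l0 \<phi> v" if "v \<in> space D0" for v
        using lip_l0[OF \<phi>_H f_Hhat, of v] that by (simp add: T.space_D0)
      hence "risk D0 l0 (f \<theta>) = risk D0 l0 \<phi>"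
        unfolding risk_def by (intro Bochner_Integration.integral_cong) auto
      thus ?thesis using True by simp
    next
      case False
      let ?u = "\<lambda>v. (loss_at l0 (f \<theta>) v - loss_at l0 \<phi> v) / M"
      have u_int: "integrable D0 ?u"
        using T.l0_integrable[OF f_Hhat] T.l0_integrable[OF \<phi>_H] by simp
      have "ennreal (\<integral>v. \<bar>?u v\<bar> \<partial>D0) = (\<integral>\<^sup>+v. ennreal \<bar>?u v\<bar> \<partial>D0)"
        by (rule nn_integral_eq_integral[symmetric, OF integrable_abs[OF u_int]]) simp
      also have "\<dots> \<le> (\<integral>\<^sup>+v. ennreal (norm (\<phi> (fst v) - f \<theta> (fst v))) \<partial>D0)"
      proof (intro nn_integral_mono ennreal_leI)
        fix v assume "v \<in> space D0"
        hence "\<bar>loss_at l0 (f \<theta>) v - loss_at l0 \<phi> v\<bar> \<le> M * norm (\<phi> (fst v) - f \<theta> (fst v))"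
          using lip_l0[OF \<phi>_H f_Hhat, of v] by (simp add: T.space_D0 abs_minus_commute)
        thus "\<bar>?u v\<bar> \<le> norm (\<phi> (fst v) - f \<theta> (fst v))"
          using M False by (simp add: field_simps)
      qed
      also have "\<dots> \<le> ennreal \<nu>0" by (rule \<theta>(2))
      finally have abs_u: "(\<integral>v. \<bar>?u v\<bar> \<partial>D0) \<le> \<nu>0"
        using near_universality(2) by (simp add: ennreal_le_iff)
      have u_le: "(\<integral>v. ?u v \<partial>D0) \<le> (\<integral>v. \<bar>?u v\<bar> \<partial>D0)"
        by (intro integral_mono integrable_abs u_int abs_ge_self)
      have u_eq: "(\<integral>v. ?u v \<partial>D0) = (risk D0 l0 (f \<theta>) - risk D0 l0 \<phi>) / M"
        using T.l0_integrable[OF f_Hhat] T.l0_integrable[OF \<phi>_H] by (simp add: risk_def)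
      have "(risk D0 l0 (f \<theta>) - risk D0 l0 \<phi>) / M \<le> \<nu>0"
        using order_trans[OF u_le abs_u] unfolding u_eq .
      thus ?thesis using M False by (simp add: field_simps)
    qed
    \<comment> \<open>The minimum over the convexified class is at most the tightened Lagrangian at
      the minimizer over \<open>H\<close>; there the tightening contributes M \<nu> times the mean
      of the multiplier.\<close>
    also have "risk D0 l0 \<phi> \<le> dual_fun D0 D l0 l H lamtight + M * \<nu> * (\<integral>v. lamtight v \<partial>D)"
    proof -
      obtain h where h: "is_arg_min (lagrangian D0 D l0 l lamtight) (\<lambda>h. h \<in> H) h"
        using minima_attained(2) lamtight(1) by blast
      hence h_H: "h \<in> H" by (simp add: is_arg_min_iff)
      obtain \<psi> where \<psi>: "is_arg_min (lagrangian D0 D l0 (tighten (M * \<nu>) l) lamtight) (\<lambda>\<phi>. \<phi> \<in> Hhat) \<psi>"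
        using minima_attained(5) lamtight(1) by blast
      have "risk D0 l0 \<phi> \<le> lagrangian D0 D l0 (tighten (M * \<nu>) l) lamtight h"
        using \<phi>(2) \<psi> h_H H_sub unfolding dual_fun_eq[OF \<psi>] by (auto simp: is_arg_min_iff intro: order_trans)
      also have "\<dots> = lagrangian D0 D l0 l lamtight h + M * \<nu> * (\<integral>v. lamtight v \<partial>D)"
        using H.weighted_integrable[OF h_H lamtight(2)] lamtight(2)
        by (simp add: lagrangian_def tight distrib_left mult.commute)
      finally show ?thesis unfolding dual_fun_eq[OF h] .
    qed
    also have "dual_fun D0 D l0 l H lamtight \<le> dual_fun D0 D l0 l H lamstar"
      using dual_attained(1) lamtight(1) by (auto simp: is_arg_max_linorder)
    finally show ?thesis by (simp add: \<Delta>_def)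
  qed

  \<comment> \<open>Uniform convergence for the constraint loss times the multiplier\<close>
  have \<delta>: "0 < \<delta>" "\<delta> < 1" using delta by auto
  have uc: "0 \<le> r Q N \<delta>" "with_prob_ge (Pi\<^sub>M {..<N} (\<lambda>_. Q)) (1 - \<delta>)
      (\<lambda>S. \<forall>h\<in>H. \<bar>(\<integral>v. k h v \<partial>Q) - 1 / real N * (\<Sum>n<N. k h (S n))\<bar> \<le> r Q N \<delta>)"
    if "uniform_convergence Z H k r" "Q \<in> space (prob_algebra Z)"
    for k :: "('x \<Rightarrow> 'y) \<Rightarrow> 'x \<times> 'y \<Rightarrow> real" and r Q
    using that N delta unfolding uniform_convergence_def by blast+
  have \<zeta>: "0 \<le> \<zeta>0 D0 N \<delta>" "0 \<le> \<zeta> D N \<delta>"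
    using uc(1)[OF uniform_conv(1) spaces(3)] uc(1)[OF uniform_conv(2) spaces(4)] by auto

  have abs_lamstar: "AE v in D. \<bar>lamstar v\<bar> \<le> \<gamma>"
    using esssup_AE[of "\<lambda>w. ereal \<bar>lamstar w\<bar>" D]
  proof eventually_elim
    case (elim v)
    hence "ereal \<bar>lamstar v\<bar> \<le> ereal \<gamma>" using bounded_multiplier by (rule order_trans)
    thus ?case by simp
  qed
  have \<gamma>: "0 \<le> \<gamma>"
  proof -
    have "AE v in D. 0 \<le> \<gamma>" using abs_lamstar by eventually_elim linarith
    thus ?thesis using D.AE_const by simp
  qed
  have c: "0 \<le> c"
  proof -
    have "AE v in D. 0 \<le> c"
      using fstar_feas AE_space
    proof eventually_elim
      case (elim v)
      thus ?case using l_range(1)[of fstar v] fstar_H H_sub by (auto simp: space_D)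
    qed
    thus ?thesis using D.AE_const by simp
  qed
  \<comment> \<open>A version of the multiplier that is nonnegative everywhere is needed, because it
    is evaluated at sample points. Truncation of \<open>lamstar\<close> to [0, \<gamma>] changes it
    only on a null set.\<close>
  obtain a where a_nonneg: "\<And>v. 0 \<le> a v"
    and a_uc: "with_prob_ge (Pi\<^sub>M {..<N} (\<lambda>_. D)) (1 - \<delta>)
      (\<lambda>S. \<forall>h\<in>H. (\<integral>v. lamstar v * loss_at l h v \<partial>D) - 1 / real N * (\<Sum>n<N. a (S n) * loss_at l h (S n))
              \<le> \<gamma> * \<zeta> D N \<delta>)"
  proof (cases "c \<le> B \<and> 0 < B \<and> 0 < \<gamma>")
    case True
    let ?a = "\<lambda>v. max 0 (min \<gamma> (lamstar v))"
    have meas: "?a \<in> borel_measurable Z"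
    proof -
      have "lamstar \<in> borel_measurable Z"
        using lamstar(2) by (simp cong: measurable_cong_sets add: sets_D borel_measurable_integrable flip: sets_D)
      thus ?thesis by measurable
    qed
    have loss_class: "rademacher_class Z H (loss_at l) (B + \<bar>c\<bar>) D"
    proof
      show "H \<noteq> {}" using fstar_H by blast
      show "0 \<le> B + \<bar>c\<bar>" using True by simp
    qed (use H.l_bounded prob_D sets_D rates(2) in \<open>auto simp: rademacher_rate_def\<close>)
    \<comment> \<open>The upper part is at most \<gamma> (B - c), using c \<le> B, and the negated
      lower part at most \<gamma> c, using 0 \<le> c. The sum \<gamma> B matches the constant
      \<open>B\<close> in the rate of \<open>l\<close>.\<close>
    have range: "?a v * loss_at l h v - ?a v' * loss_at l h v' \<le> \<gamma> * B"
      if h: "h \<in> H" and v: "v \<in> space Z" "v' \<in> space Z" for h v v'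
    proof -
      have h': "h \<in> Hhat" using h H_sub by blast
      have "?a v * loss_at l h v \<le> ?a v * (B - c)"
        using l_range(2)[OF h' v(1)] by (intro mult_left_mono) auto
      also have "\<dots> \<le> \<gamma> * (B - c)" using True by (intro mult_right_mono) auto
      finally have 1: "?a v * loss_at l h v \<le> \<gamma> * (B - c)" .
      have "?a v' * (- loss_at l h v') \<le> ?a v' * c"
        using l_range(1)[OF h' v(2)] by (intro mult_left_mono) auto
      also have "\<dots> \<le> \<gamma> * c" using \<gamma> c by (intro mult_right_mono) auto
      finally show ?thesis using 1 by (simp add: right_diff_distrib)
    qed
    have "with_prob_ge (Pi\<^sub>M {..<N} (\<lambda>_. D)) (1 - \<delta>)
      (\<lambda>S. \<forall>h\<in>H. (\<integral>v. ?a v * loss_at l h v \<partial>D) - 1 / real N * (\<Sum>n<N. ?a (S n) * loss_at l h (S n))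
              \<le> \<gamma> * \<zeta> D N \<delta>)"
    proof (rule rademacher_class.weighted_uniform_convergence[OF loss_class spaces(4) H.l_measurable
          uniform_conv(2) rates(2) meas _ range _ _ N delta])
      show "0 < \<gamma>" "0 < B" using True by auto
      fix v show "0 \<le> ?a v \<and> ?a v \<le> \<gamma>" using \<gamma> by auto
    qed
    moreover have "(\<integral>v. ?a v * loss_at l h v \<partial>D) = (\<integral>v. lamstar v * loss_at l h v \<partial>D)" if "h \<in> H" for h
    proof (rule integral_cong_AE)
      have l_meas: "loss_at l h \<in> borel_measurable D" by (rule H.l_measurable_D[OF that])
      show "(\<lambda>v. ?a v * loss_at l h v) \<in> borel_measurable D"
        using meas l_meas by (intro borel_measurable_times) (simp_all cong: measurable_cong_sets add: sets_D)
      show "(\<lambda>v. lamstar v * loss_at l h v) \<in> borel_measurable D"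
        using lamstar(2) l_meas by (intro borel_measurable_times) auto
      show "AE v in D. ?a v * loss_at l h v = lamstar v * loss_at l h v"
        using lamstar(3) abs_lamstar by eventually_elim auto
    qed
    ultimately show ?thesis by (intro that[of ?a]) (auto elim!: with_prob_ge_mono)
  next
    case False
    \<comment> \<open>In each remaining case the products vanish almost everywhere, so the zero
      function can replace the multiplier on the sample.\<close>
    have zero: "AE v in D. lamstar v * loss_at l h v = 0" if h: "h \<in> H" for h
    proof -
      consider "B < c" | "\<gamma> = 0" | "B = 0" "c = 0"
        using False c \<gamma> by force
      thus ?thesis
      proof cases
        case 1
        have "AE v in D. lamstar v = 0"
        proof (rule H.dual_maximizer_eq_0[OF _ minima_attained(2) dual_attained(1)])
          show "loss_at l \<phi> v < 0" if "\<phi> \<in> H" "v \<in> space Z" for \<phi> v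
            using l_range(2)[of \<phi> v] that H_sub 1 by auto
        qed
        thus ?thesis by eventually_elim simp
      next
        case 2
        thus ?thesis using abs_lamstar by (auto elim: eventually_mono)
      next
        case 3
        show ?thesis
          using AE_space
        proof eventually_elim
          case (elim v)
          thus ?case using l_range[of h v] h H_sub 3 by (auto simp: space_D)
        qed
      qed
    qed
    interpret S: prob_space "Pi\<^sub>M {..<N} (\<lambda>_. D)" by (intro prob_space_PiM prob_D)
    have "(\<integral>v. lamstar v * loss_at l h v \<partial>D) = 0" if "h \<in> H" for h
      by (rule integral_eq_zero_AE[OF zero[OF that]])
    thus ?thesis
      using \<gamma> \<zeta> \<delta> by (intro that[of "\<lambda>_. 0"]) (auto simp: with_prob_ge_def S.prob_space intro!: bexI[of _ "space (Pi\<^sub>M {..<N} (\<lambda>_. D))"])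
  qed

  \<comment> \<open>The events on the samples\<close>
  have fstar_sample: "AE w in P. \<forall>n<N. loss_at l fstar (z n w) \<le> 0"
  proof -
    have "AE w in P. loss_at l fstar (z n w) \<le> 0" if "n \<in> {..<N}" for n
    proof -
      have d: "distr P Z (z n) = D" using samples(6) that by simp
      have "z n \<in> measurable P Z"
        using samples(5) that unfolding P.indep_vars_def by blast
      moreover have "AE v in distr P Z (z n). loss_at l fstar v \<le> 0" unfolding d by (rule fstar_feas)
      ultimately show ?thesis by (rule AE_distrD)
    qed
    hence "AE w in P. \<forall>n\<in>{..<N}. loss_at l fstar (z n w) \<le> 0"
      by (intro AE_finite_allI) auto
    thus ?thesis by eventually_elim simp
  qed
  note obj_uc = P.with_prob_ge_sample[OF N samples(3,4) uc(2)[OF uniform_conv(1) spaces(3)]]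
  note ind_uc = P.with_prob_ge_sample[OF N samples(5,6) uc(2)[OF uniform_conv(3) spaces(4)]]
  note con_uc = P.with_prob_ge_sample[OF N samples(5,6) a_uc]
  note sure = P.with_prob_ge_conj[OF P.with_prob_ge_AE[OF estimator] P.with_prob_ge_AE[OF fstar_sample]]
  note events = P.with_prob_ge_conj[OF obj_uc P.with_prob_ge_conj[OF ind_uc P.with_prob_ge_conj[OF con_uc sure]]]
  \<comment> \<open>Three events cost \<delta> each and the two almost sure ones cost nothing, so
    the total of 3 \<delta> lies within the allowance of 5 \<delta>.\<close>
  have "1 - 5 * \<delta> \<le> 1 - (\<delta> + (\<delta> + (\<delta> + (0 + 0))))" using \<delta> by simp
  note events_le = with_prob_ge_le[OF events this]

  \<comment> \<open>Deterministic bounds on the good event\<close>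
  show ?thesis
  proof (rule with_prob_ge_mono[OF events_le])
    fix w
    let ?obj = "\<lambda>n. z0 n w" and ?con = "\<lambda>n. z n w"
    assume ev: "(\<forall>h\<in>H. \<bar>(\<integral>v. loss_at l0 h v \<partial>D0)
          - 1 / real N * (\<Sum>n<N. loss_at l0 h ((\<lambda>n\<in>{..<N}. z0 n w) n))\<bar> \<le> \<zeta>0 D0 N \<delta>) \<and>
      (\<forall>h\<in>H. \<bar>(\<integral>v. of_bool (loss_at l h v \<le> 0) \<partial>D)
          - 1 / real N * (\<Sum>n<N. of_bool (loss_at l h ((\<lambda>n\<in>{..<N}. z n w) n) \<le> 0))\<bar> \<le> \<zeta>I D N \<delta>) \<and>
      (\<forall>h\<in>H. (\<integral>v. lamstar v * loss_at l h v \<partial>D)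
          - 1 / real N * (\<Sum>n<N. a ((\<lambda>n\<in>{..<N}. z n w) n) * loss_at l h ((\<lambda>n\<in>{..<N}. z n w) n)) \<le> \<gamma> * \<zeta> D N \<delta>) \<and>
      is_arg_min (emp_risk N ?obj l0) (\<lambda>h. h \<in> emp_feasible N ?con l H) (fbar w) \<and>
      (\<forall>n<N. loss_at l fstar (z n w) \<le> 0)"
    have obj: "\<bar>risk D0 l0 h - emp_risk N ?obj l0 h\<bar> \<le> \<zeta>0 D0 N \<delta>" if "h \<in> H" for h
      using ev that by (simp add: risk_def emp_risk_def)
    have f_H: "fbar w \<in> H" and f_feas: "\<And>n. n < N \<Longrightarrow> loss_at l (fbar w) (z n w) \<le> 0"
      and f_min: "\<And>h. h \<in> emp_feasible N ?con l H \<Longrightarrow> emp_risk N ?obj l0 (fbar w) \<le> emp_risk N ?obj l0 h"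
      using ev by (auto simp: is_arg_min_iff emp_feasible_def)
    have "fstar \<in> emp_feasible N ?con l H" using ev fstar_H by (simp add: emp_feasible_def)
    from f_min[OF this] obj[OF fstar_H] obj[OF f_H]
    have upper: "risk D0 l0 (fbar w) - risk D0 l0 fstar \<le> 2 * \<zeta>0 D0 N \<delta>" by linarith
    have "(\<Sum>n<N. a (z n w) * loss_at l (fbar w) (z n w)) \<le> 0"
      using a_nonneg f_feas by (intro sum_nonpos mult_nonneg_nonpos) auto
    hence "1 / real N * (\<Sum>n<N. a (z n w) * loss_at l (fbar w) (z n w)) \<le> 0"
      by (intro mult_nonneg_nonpos) auto
    moreover have "(\<integral>v. lamstar v * loss_at l (fbar w) v \<partial>D)
        - 1 / real N * (\<Sum>n<N. a (z n w) * loss_at l (fbar w) (z n w)) \<le> \<gamma> * \<zeta> D N \<delta>"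
      using ev f_H by simp
    ultimately have slack: "(\<integral>v. lamstar v * loss_at l (fbar w) v \<partial>D) \<le> \<gamma> * \<zeta> D N \<delta>" by linarith
    obtain h where h: "is_arg_min (lagrangian D0 D l0 l lamstar) (\<lambda>h. h \<in> H) h"
      using minima_attained(2) lamstar(1) by blast
    have "dual_fun D0 D l0 l H lamstar \<le> lagrangian D0 D l0 l lamstar (fbar w)"
      unfolding dual_fun_eq[OF h] using h f_H by (simp add: is_arg_min_iff)
    hence lower: "risk D0 l0 fstar - risk D0 l0 (fbar w) \<le> \<Delta> + \<gamma> * \<zeta> D N \<delta>"
      using gap slack by (simp add: lagrangian_def)
    have "0 \<le> \<gamma> * \<zeta> D N \<delta>" using \<gamma> \<zeta>(2) by simp
    \<comment> \<open>Optimality costs 2 \<zeta>0 on the upper side, duality costs the gap plus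
      \<gamma> \<zeta> on the lower side; all terms are nonnegative, so their sum covers
      both.\<close>
    hence "\<bar>risk D0 l0 (fbar w) - primal_value D0 D l0 l H\<bar> \<le> \<Delta> + 3 * \<zeta>0 D0 N \<delta> + \<gamma> * \<zeta> D N \<delta>"
      using upper lower \<Delta> \<zeta>(1) unfolding P_star by linarith
    moreover have "1 - \<zeta>I D N \<delta> \<le> measure D {v \<in> space D. loss_at l (fbar w) v \<le> 0}"
    proof -
      have "(\<integral>v. of_bool (loss_at l (fbar w) v \<le> 0) \<partial>D)
          = (\<integral>v. indicator {v \<in> space D. loss_at l (fbar w) v \<le> 0} v \<partial>D)"
        by (intro Bochner_Integration.integral_cong) (auto simp: indicator_def)
      also have "\<dots> = measure D {v \<in> space D. loss_at l (fbar w) v \<le> 0}"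
        by (simp add: Int_absorb2 subset_iff)
      finally have mean: "(\<integral>v. of_bool (loss_at l (fbar w) v \<le> 0) \<partial>D) = \<dots>" .
      \<comment> \<open>The estimator satisfies every sampled constraint, so the empirical frequency
        is 1 and the indicator rate alone bounds the violation probability.\<close>
      have avg: "1 / real N * (\<Sum>n<N. of_bool (loss_at l (fbar w) ((\<lambda>n\<in>{..<N}. z n w) n) \<le> 0)) = 1"
        using f_feas N by simp
      have "\<bar>(\<integral>v. of_bool (loss_at l (fbar w) v \<le> 0) \<partial>D)
          - 1 / real N * (\<Sum>n<N. of_bool (loss_at l (fbar w) ((\<lambda>n\<in>{..<N}. z n w) n) \<le> 0))\<bar> \<le> \<zeta>I D N \<delta>"
        using ev f_H by blast
      thus ?thesis unfolding mean avg by linarith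
    qed
    ultimately show "\<bar>risk D0 l0 (fbar w) - primal_value D0 D l0 l H\<bar>
        \<le> (M * \<nu> * (\<integral>v. lamtight v \<partial>D) + M * \<nu>0) + 3 * \<zeta>0 D0 N \<delta> + \<gamma> * \<zeta> D N \<delta>
      \<and> measure D {v \<in> space D. loss_at l (fbar w) v \<le> 0} \<ge> 1 - \<zeta>I D N \<delta>"
      by (simp add: \<Delta>_def)
  qed
qed

end
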